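(* Let $I=(a_-,a_+)\subset\mathbb{R}$ be a bounded open interval, $p\in[1,\infty)$, let $w\in L^1(I)$ be a weight that is $\mu_w$-a.e. non-critical, and let $m\ge1$ be an integer. Let $x_0\in\bar I$, $\bar k\in\{0,\dots,m-1\}$ and $\Delta k:=m-\bar k$. If $x_0\notin\bar I_{cr}^{\,\Delta k-1,p}(w)$, then there exists a neighbourhood $\mathcal{V}\ni x_0$, relatively open in $\bar I$, such that $$H^{m,p}_{\mu_w}\hookrightarrow W^{\bar k+1,1}(\mathcal{V}\cap I),$$ and, as a result, for every $u\in H^{m,p}_{\mu_w}$ there exists a function $\breve u\in C^{\bar k}(\mathcal{V}\cap I)$ such that for all $k\in\{0,\dots,\bar k\}$ $$u=\breve u\quad\text{and}\quad D^k_{\mu_w}u=D^k\breve u\qquad \mathcal{L}^1\text{-a.e. on }\mathcal{V},$$ where $D^k\breve u$ is the classical derivative. If $\bar I_{cr}^{\,\Delta k-1,p}(w)=\varnothing$, then the set $\mathcal{V}\cap I$ above may be replaced by $I$.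
   Context: A weight is a non-negative function $w\in L^1(I)$, $I=(a_-,a_+)$ bounded. $\mathcal{L}^1$ is Lebesgue measure, $\mu_w:=w\,\mathcal{L}^1$ restricted to $I$, and $L^p_{\mu_w}$ is the Lebesgue space with norm $(\int_I w|u|^p\,dx)^{1/p}$. $p'=p/(p-1)$ is the Hölder conjugate ($p'=\infty$ if $p=1$). Convention: $\alpha/0=0$ if $\alpha=0$ and $\alpha/0=\infty$ if $\alpha>0$. $\mathcal{D}(\mathbb{R})$ denotes smooth compactly supported functions on $\mathbb{R}$ (they need not vanish at $a_\pm$). Critical set of order $\alpha\in[0,\infty)$: for $p\in(1,\infty)$, $$\bar I_{cr}^{\,\alpha,p}(w):=\Big\{x_0\in\bar I:\ \forall\varepsilon>0\ \int_{\bar I\cap B(x_0,\varepsilon)}\Big(\frac{|x-x_0|^\alpha}{(w(x))^{1/p}}\Big)^{p'}dx=\infty\Big\},$$ and for $p=1$, $\bar I_{cr}^{\,\alpha,1}(w):=\{x_0\in\bar I:\ \forall\varepsilon>0\ \ \mathcal{L}^1\text{-}\mathrm{ess\,sup}\{|x-x_0|^\alpha/w(x): x\in\bar I\cap B(x_0,\varepsilon)\}=\infty\}$. The weight $w$ is $\mu_w$-a.e. non-critical if $\mu_w(\bar I_{cr}^{\,0,p}(w))=0$. For such $w$ and an integer $m\ge1$ let $H^{m,p}_{\mu_w}$ be the set of $u\in L^p_{\mu_w}$ for which there exist $u_h\in\mathcal{D}(\mathbb{R})$ and $v_1,\dots,v_m\in L^p_{\mu_w}$ with $u_h\to u$ and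 $D^ku_h\to v_k$ in $L^p_{\mu_w}$, $k=1,\dots,m$ (classical derivatives). The $v_k$ are uniquely determined by $u$ and are denoted $D^k_{\mu_w}u$ (tangential derivatives), with $D^0_{\mu_w}u:=u$. The norm is $\|u\|_{H^{m,p}_{\mu_w}}=(\sum_{k=0}^m\|D^k_{\mu_w}u\|^p_{L^p_{\mu_w}})^{1/p}$. $W^{j,1}(U)$ is the classical Sobolev space (with respect to Lebesgue measure) on an open set $U\subset\mathbb{R}$, and $\hookrightarrow$ means continuous embedding (by restriction). *)

theory Defs
  imports "HOL-Analysis.Analysis" "HOL-Probability.Essential_Supremum"
begin

text \<open>
  Function classes are handled through representatives: functions are total on the reals, only
  their values on the set under consideration matter, and equality in a Lebesgue space is
  almost-everywhere equality.
\<close>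

subsection \<open>Lebesgue spaces and weights\<close>

definition Lp_space :: "real measure \<Rightarrow> real \<Rightarrow> (real \<Rightarrow> real) set" where
  "Lp_space M p = {u \<in> borel_measurable M. integrable M (\<lambda>x. \<bar>u x\<bar> powr p)}"

definition Lp_norm :: "real measure \<Rightarrow> real \<Rightarrow> (real \<Rightarrow> real) \<Rightarrow> real" where
  "Lp_norm M p u = (\<integral>x. \<bar>u x\<bar> powr p \<partial>M) powr (1 / p)"

definition weight_on :: "real \<Rightarrow> real \<Rightarrow> (real \<Rightarrow> real) \<Rightarrow> bool" where
  "weight_on a b w \<longleftrightarrow>
     integrable (lebesgue_on {a<..<b}) w \<and> (\<forall>x\<in>{a<..<b}. 0 \<le> w x)"

definition weight_measure :: "real \<Rightarrow> real \<Rightarrow> (real \<Rightarrow> real) \<Rightarrow> real measure" where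
  "weight_measure a b w = density (lebesgue_on {a<..<b}) (\<lambda>x. ennreal (w x))"

subsection \<open>Critical sets\<close>

text \<open>Extension of "t powr r", for "r > 0", to "t = \<infinity>".\<close>

definition ennreal_powr :: "ennreal \<Rightarrow> real \<Rightarrow> ennreal" where
  "ennreal_powr t r = (if t = \<infinity> then \<infinity> else ennreal (enn2real t powr r))"

text \<open>Unlike powr, this takes the value 1 when base and exponent are both 0.\<close>

definition dist_power :: "real \<Rightarrow> real \<Rightarrow> real \<Rightarrow> real" where
  "dist_power \<alpha> x0 x = (if \<alpha> = 0 then 1 else \<bar>x - x0\<bar> powr \<alpha>)"

text \<open>
  Division on the type ennreal satisfies "0 / 0 = 0" and "c / 0 = \<infinity>" for
  "c > 0", as required. The values of the weight at the two end points are irrelevant.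
\<close>

definition critical_set :: "real \<Rightarrow> real \<Rightarrow> (real \<Rightarrow> real) \<Rightarrow> real \<Rightarrow> real \<Rightarrow> real set" where
  "critical_set a b w \<alpha> p =
     (if p = 1 then
        {x0 \<in> {a..b}. \<forall>\<epsilon>>0.
           esssup (lebesgue_on ({a..b} \<inter> ball x0 \<epsilon>))
             (\<lambda>x. ennreal (dist_power \<alpha> x0 x) / ennreal (w x)) = \<infinity>}
      else
        {x0 \<in> {a..b}. \<forall>\<epsilon>>0.
           (\<integral>\<^sup>+x. ennreal_powr
                    (ennreal (dist_power \<alpha> x0 x) / ennreal (w x powr (1 / p)))
                    (p / (p - 1))
              \<partial>lebesgue_on ({a..b} \<inter> ball x0 \<epsilon>)) = \<infinity>})"

definition ae_noncritical :: "real \<Rightarrow> real \<Rightarrow> (real \<Rightarrow> real) \<Rightarrow> real \<Rightarrow> bool" where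
  "ae_noncritical a b w p \<longleftrightarrow>
     critical_set a b w 0 p \<inter> {a<..<b} \<in> null_sets (weight_measure a b w)"

subsection \<open>Test functions and weighted Sobolev spaces\<close>

definition test_functions :: "real set \<Rightarrow> (real \<Rightarrow> real) set" where
  "test_functions U = {\<phi>. (\<forall>k x. (deriv ^^ k) \<phi> differentiable at x) \<and>
     compact (closure {x. \<phi> x \<noteq> 0}) \<and> closure {x. \<phi> x \<noteq> 0} \<subseteq> U}"

definition has_tangential_derivs ::
  "real \<Rightarrow> real \<Rightarrow> (real \<Rightarrow> real) \<Rightarrow> real \<Rightarrow> nat \<Rightarrow> (real \<Rightarrow> real) \<Rightarrow> (nat \<Rightarrow> real \<Rightarrow> real) \<Rightarrow> bool"
where
  "has_tangential_derivs a b w p m u v \<longleftrightarrow>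
     v 0 = u \<and>
     (\<forall>k\<le>m. v k \<in> Lp_space (weight_measure a b w) p) \<and>
     (\<exists>\<phi> :: nat \<Rightarrow> real \<Rightarrow> real.
        (\<forall>h. \<phi> h \<in> test_functions UNIV) \<and>
        (\<forall>k\<le>m. (\<lambda>h. Lp_norm (weight_measure a b w) p (\<lambda>x. (deriv ^^ k) (\<phi> h) x - v k x))
                   \<longlonglongrightarrow> 0))"

definition H_space ::
  "real \<Rightarrow> real \<Rightarrow> (real \<Rightarrow> real) \<Rightarrow> real \<Rightarrow> nat \<Rightarrow> (real \<Rightarrow> real) set" where
  "H_space a b w p m = {u. \<exists>v. has_tangential_derivs a b w p m u v}"

text \<open>
  The tangential derivatives are unique up to null sets of the weighted measure when the weight
  is almost everywhere non-critical; the choice operator merely picks representatives.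
\<close>

definition tangential_deriv ::
  "real \<Rightarrow> real \<Rightarrow> (real \<Rightarrow> real) \<Rightarrow> real \<Rightarrow> nat \<Rightarrow> nat \<Rightarrow> (real \<Rightarrow> real) \<Rightarrow> real \<Rightarrow> real" where
  "tangential_deriv a b w p m k u = (SOME v. has_tangential_derivs a b w p m u v) k"

definition H_norm ::
  "real \<Rightarrow> real \<Rightarrow> (real \<Rightarrow> real) \<Rightarrow> real \<Rightarrow> nat \<Rightarrow> (real \<Rightarrow> real) \<Rightarrow> real" where
  "H_norm a b w p m u =
     (\<Sum>k\<le>m. Lp_norm (weight_measure a b w) p (tangential_deriv a b w p m k u) powr p)
       powr (1 / p)"

subsection \<open>Classical Sobolev spaces and spaces of differentiable functions\<close>

definition locally_integrable_on :: "(real \<Rightarrow> real) \<Rightarrow> real set \<Rightarrow> bool" where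
  "locally_integrable_on u U \<longleftrightarrow>
     (\<forall>K. compact K \<and> K \<subseteq> U \<longrightarrow> integrable (lebesgue_on K) u)"

definition has_weak_deriv :: "real set \<Rightarrow> nat \<Rightarrow> (real \<Rightarrow> real) \<Rightarrow> (real \<Rightarrow> real) \<Rightarrow> bool" where
  "has_weak_deriv U k u v \<longleftrightarrow>
     locally_integrable_on u U \<and> locally_integrable_on v U \<and>
     (\<forall>\<phi>\<in>test_functions U.
        (\<integral>x. u x * (deriv ^^ k) \<phi> x \<partial>lebesgue_on U) =
        (- 1) ^ k * (\<integral>x. v x * \<phi> x \<partial>lebesgue_on U))"

definition weak_deriv :: "real set \<Rightarrow> nat \<Rightarrow> (real \<Rightarrow> real) \<Rightarrow> real \<Rightarrow> real" where
  "weak_deriv U k u = (SOME v. has_weak_deriv U k u v)"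

definition W1_space :: "real set \<Rightarrow> nat \<Rightarrow> (real \<Rightarrow> real) set" where
  "W1_space U j = {u. integrable (lebesgue_on U) u \<and>
     (\<forall>k\<in>{1..j}. \<exists>v. has_weak_deriv U k u v \<and> integrable (lebesgue_on U) v)}"

definition W1_norm :: "real set \<Rightarrow> nat \<Rightarrow> (real \<Rightarrow> real) \<Rightarrow> real" where
  "W1_norm U j u = (\<integral>x. \<bar>u x\<bar> \<partial>lebesgue_on U) +
     (\<Sum>k=1..j. (\<integral>x. \<bar>weak_deriv U k u x\<bar> \<partial>lebesgue_on U))"

text \<open>
  Boundedness of the restriction map. It is required for every representative, which includes
  that the map is well defined on classes modulo null sets of the weighted measure.
\<close>

definition H_embeds_in_W1 ::
  "real \<Rightarrow> real \<Rightarrow> (real \<Rightarrow> real) \<Rightarrow> real \<Rightarrow> nat \<Rightarrow> real set \<Rightarrow> nat \<Rightarrow> bool" where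
  "H_embeds_in_W1 a b w p m U j \<longleftrightarrow>
     (\<exists>C. \<forall>u \<in> H_space a b w p m.
        u \<in> W1_space U j \<and> W1_norm U j u \<le> C * H_norm a b w p m u)"

definition Ck_on :: "nat \<Rightarrow> real set \<Rightarrow> (real \<Rightarrow> real) set" where
  "Ck_on k U = {f. (\<forall>i<k. \<forall>x\<in>U. (deriv ^^ i) f differentiable at x) \<and>
     (\<forall>i\<le>k. continuous_on U ((deriv ^^ i) f))}"

end

theory Submission
  imports Defs
begin

text \<open>
  Write \<open>\<mu>\<close> for the weighted measure, \<open>\<kappa>\<close> for the order of regularity that is claimed, and
  \<open>j = m - \<kappa> - 1\<close> for the order of the critical set. Everything rests on one a priori estimate for
  smooth functions: near a point \<open>x0\<close> outside the critical set, the \<open>L\<^sup>1\<close> norms (with respect to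
  Lebesgue measure) of the derivatives of order \<open>0, ..., \<kappa> + 1\<close> are bounded by the sum of the
  \<open>L\<^sup>p\<^sub>\<mu>\<close> norms of the derivatives of order \<open>0, ..., m\<close>
  (\<open>noncritical_controls_derivs\<close>).

  The estimate has two ingredients. First, \<open>x0\<close> being noncritical says exactly that
  \<open>\<bar>x - x0\<bar>^j / w^(1/p)\<close> lies in the dual Lebesgue space near \<open>x0\<close>, so the Hoelder inequality bounds
  the integral of \<open>\<bar>x - x0\<bar>^j \<bar>f\<bar>\<close> by the \<open>L\<^sup>p\<^sub>\<mu>\<close> norm of \<open>f\<close> (\<open>noncritical_bound\<close>).
  Secondly, a Hardy type inequality trades one derivative for one power of the distance: the integral
  of \<open>\<bar>x - x0\<bar>^e \<bar>f\<bar>\<close> is controlled by that of \<open>\<bar>x - x0\<bar>^(e+1) \<bar>f'\<bar>\<close>, up to a contribution of \<open>f\<close>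
  away from \<open>x0\<close>, where the power of the distance is harmless (\<open>hardy\<close>). Starting from the derivative
  of order \<open>m\<close> with the exponent \<open>j\<close> and going down one order at a time, the exponent reaches \<open>0\<close> at
  the order \<open>\<kappa> + 1\<close> and stays there. If there are no critical points at all, finitely many such
  neighbourhoods cover the compact closed interval and the estimate holds globally
  (\<open>no_critical_controls_derivs\<close>).

  Noncriticality also forces \<open>w > 0\<close> almost everywhere near \<open>x0\<close>, so \<open>\<mu>\<close>-almost everywhere statements
  are Lebesgue-almost everywhere statements there. Hence, if smooth \<open>\<phi>\<^sub>h\<close> approximate \<open>u\<close> and its
  tangential derivatives \<open>v\<^sub>k\<close> in \<open>L\<^sup>p\<^sub>\<mu>\<close>, the Fatou lemma along an almost everywhere convergent
  subsequence turns the a priori estimate into convergence of the \<open>k\<close>-th derivatives of \<open>\<phi>\<^sub>h\<close> to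
  \<open>v\<^sub>k\<close> in \<open>L\<^sup>1\<close>, for \<open>k \<le> \<kappa> + 1\<close> (\<open>limit_deriv_bound\<close>). Integration by parts passes to the limit,
  so \<open>v\<^sub>k\<close> is the weak derivative of \<open>u\<close>; and since \<open>L\<^sup>1\<close> convergence of a function and of its
  derivative on an interval implies uniform convergence, the derivatives of order at most \<open>\<kappa>\<close>
  converge uniformly, to the classical derivatives of a \<open>C\<^sup>\<kappa>\<close> representative
  (\<open>Ck_representative\<close>). The Sobolev norm is defined through an arbitrary choice of weak derivatives;
  that it can be computed from the \<open>v\<^sub>k\<close> needs the fundamental lemma of the calculus of variations, and
  therefore smooth bump functions (\<open>has_weak_deriv_unique\<close>).
\<close>

section \<open>Smooth functions and test functions\<close>

definition smooth :: "(real \<Rightarrow> real) \<Rightarrow> bool" where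
  "smooth f \<longleftrightarrow> (\<forall>k x. (deriv ^^ k) f differentiable at x)"

text \<open>
  Differentiability up to a finite order, unfolded from the first derivative onwards: an induction on
  the order can then use the product and chain rules, which produce new functions, instead of a closed
  formula for iterated derivatives.
\<close>

fun diff_upto :: "nat \<Rightarrow> (real \<Rightarrow> real) \<Rightarrow> bool" where
  "diff_upto 0 f \<longleftrightarrow> (\<forall>x. f differentiable at x)"
| "diff_upto (Suc n) f \<longleftrightarrow> (\<forall>x. f differentiable at x) \<and> diff_upto n (deriv f)"

lemma diff_upto_iff: "diff_upto n f \<longleftrightarrow> (\<forall>k\<le>n. \<forall>x. (deriv ^^ k) f differentiable at x)"
proof (induction n arbitrary: f)
  case (Suc n)
  have "(\<forall>k\<le>Suc n. \<forall>x. (deriv ^^ k) f differentiable at x) \<longleftrightarrow>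
      (\<forall>x. f differentiable at x) \<and> (\<forall>k\<le>n. \<forall>x. (deriv ^^ Suc k) f differentiable at x)"
    by (metis (no_types, lifting) Suc_le_mono funpow_0 le0 not0_implies_Suc)
  then show ?case
    by (simp add: Suc.IH funpow_Suc_right del: funpow.simps)
qed auto

text \<open>
  Closure properties of smooth functions are proved order by order through this characterisation.
\<close>

lemma smooth_iff_diff_upto: "smooth f \<longleftrightarrow> (\<forall>n. diff_upto n f)"
  unfolding smooth_def diff_upto_iff by blast

lemma diff_upto_SucD: "diff_upto (Suc n) f \<Longrightarrow> diff_upto n f"
  by (simp add: diff_upto_iff)

lemma DERIV_deriv_real: "f differentiable at x \<Longrightarrow> (f has_real_derivative deriv f x) (at x)"
  for f :: "real \<Rightarrow> real"
  using DERIV_deriv_iff_real_differentiable by blast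

lemma diff_upto_add: "diff_upto n f \<Longrightarrow> diff_upto n g \<Longrightarrow> diff_upto n (\<lambda>x. f x + g x)"
proof (induction n arbitrary: f g)
  case (Suc n)
  have "deriv (\<lambda>x. f x + g x) = (\<lambda>x. deriv f x + deriv g x)"
    using Suc.prems by (intro ext DERIV_imp_deriv derivative_intros DERIV_deriv_real) auto
  then show ?case using Suc by (auto intro!: derivative_intros)
qed (auto intro: derivative_intros)

lemma diff_upto_mult: "diff_upto n f \<Longrightarrow> diff_upto n g \<Longrightarrow> diff_upto n (\<lambda>x. f x * g x)"
proof (induction n arbitrary: f g)
  case (Suc n)
  have "deriv (\<lambda>x. f x * g x) = (\<lambda>x. f x * deriv g x + deriv f x * g x)"
    using Suc.prems by (intro ext DERIV_imp_deriv DERIV_mult' DERIV_deriv_real) auto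
  moreover have "diff_upto n f" "diff_upto n g"
    using Suc.prems by (auto dest!: diff_upto_SucD simp del: diff_upto.simps)
  ultimately show ?case using Suc by (auto intro!: differentiable_mult diff_upto_add)
qed (auto intro: differentiable_mult)

lemma diff_upto_affine: "diff_upto n f \<Longrightarrow> diff_upto n (\<lambda>x. c * f (\<alpha> * x + \<beta>))"
proof (induction n arbitrary: f c)
  case 0
  have "((\<lambda>x. c * f (\<alpha> * x + \<beta>)) has_real_derivative c * (deriv f (\<alpha> * x + \<beta>) * \<alpha>)) (at x)" for x
    using 0 by (auto intro!: derivative_eq_intros DERIV_chain2[of f] DERIV_deriv_real)
  then show ?case by (auto simp: real_differentiable_def)
next
  case (Suc n)
  have D: "((\<lambda>x. c * f (\<alpha> * x + \<beta>)) has_real_derivative c * (deriv f (\<alpha> * x + \<beta>) * \<alpha>)) (at x)" for x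
    using Suc.prems by (auto intro!: derivative_eq_intros DERIV_chain2[of f] DERIV_deriv_real)
  have "deriv (\<lambda>x. c * f (\<alpha> * x + \<beta>)) = (\<lambda>x. (c * \<alpha>) * deriv f (\<alpha> * x + \<beta>))"
    using DERIV_imp_deriv[OF D] by (auto simp: mult_ac)
  moreover have "\<forall>x. (\<lambda>x. c * f (\<alpha> * x + \<beta>)) differentiable at x"
    using D by (auto simp: real_differentiable_def)
  ultimately show ?case using Suc by auto
qed

lemma smooth_mult: "smooth f \<Longrightarrow> smooth g \<Longrightarrow> smooth (\<lambda>x. f x * g x)"
  by (simp add: smooth_iff_diff_upto diff_upto_mult)

lemma smooth_affine: "smooth f \<Longrightarrow> smooth (\<lambda>x. f (\<alpha> * x + \<beta>))"
  using diff_upto_affine[of _ f 1] by (simp add: smooth_iff_diff_upto)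

lemma smooth_deriv: "smooth f \<Longrightarrow> smooth ((deriv ^^ k) f)"
  unfolding smooth_def by (metis comp_apply funpow_add)

lemma smooth_deriv_has_deriv:
  "smooth f \<Longrightarrow> ((deriv ^^ k) f has_real_derivative (deriv ^^ Suc k) f x) (at x)"
  unfolding smooth_def using DERIV_deriv_real[of "(deriv ^^ k) f"] by simp

lemma smooth_deriv_continuous: "smooth f \<Longrightarrow> continuous_on S ((deriv ^^ k) f)"
  by (meson DERIV_isCont continuous_at_imp_continuous_on smooth_deriv_has_deriv)

lemma deriv_funpow_diff:
  assumes "smooth f" "smooth g"
  shows "(deriv ^^ k) (\<lambda>x. f x - g x) = (\<lambda>x. (deriv ^^ k) f x - (deriv ^^ k) g x)"
proof (induction k)
  case (Suc k)
  have "deriv (\<lambda>x. (deriv ^^ k) f x - (deriv ^^ k) g x) =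
    (\<lambda>x. (deriv ^^ Suc k) f x - (deriv ^^ Suc k) g x)"
    by (intro ext DERIV_imp_deriv DERIV_diff smooth_deriv_has_deriv assms)
  then show ?case using Suc by simp
qed simp

lemma smooth_diff:
  assumes "smooth f" "smooth g"
  shows "smooth (\<lambda>x. f x - g x)"
  using assms unfolding smooth_def deriv_funpow_diff[OF assms]
  by (auto intro: differentiable_diff)

lemma test_functionsD:
  assumes "\<phi> \<in> test_functions U"
  shows "smooth \<phi>" "compact (closure {x. \<phi> x \<noteq> 0})" "closure {x. \<phi> x \<noteq> 0} \<subseteq> U"
  using assms by (auto simp: test_functions_def smooth_def)

lemma test_functionsI:
  assumes "smooth \<phi>" "compact K" "K \<subseteq> U" "\<And>x. x \<notin> K \<Longrightarrow> \<phi> x = 0"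
  shows "\<phi> \<in> test_functions U"
proof -
  have "closure {x. \<phi> x \<noteq> 0} \<subseteq> K"
    using assms by (intro closure_minimal compact_imp_closed) auto
  moreover from this have "compact (closure {x. \<phi> x \<noteq> 0})"
    using assms(2) by (metis closed_Int_compact closed_closure inf.absorb_iff1)
  ultimately show ?thesis
    using assms by (auto simp: test_functions_def smooth_def)
qed

lemma test_functions_diff:
  assumes "f \<in> test_functions UNIV" "g \<in> test_functions UNIV"
  shows "(\<lambda>x. f x - g x) \<in> test_functions UNIV"
proof (rule test_functionsI)
  show "compact (closure {x. f x \<noteq> 0} \<union> closure {x. g x \<noteq> 0})"
    using assms by (intro compact_Un) (auto dest: test_functionsD)
  show "smooth (\<lambda>x. f x - g x)"
    using assms by (intro smooth_diff) (auto dest: test_functionsD)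
  show "f x - g x = 0" if "x \<notin> closure {x. f x \<noteq> 0} \<union> closure {x. g x \<noteq> 0}" for x
    using that closure_subset[of "{x. f x \<noteq> 0}"] closure_subset[of "{x. g x \<noteq> 0}"]
    by (metis (mono_tags, lifting) UnI1 UnI2 diff_self mem_Collect_eq subsetD)
qed auto

lemma zero_test_function: "(\<lambda>x. 0) \<in> test_functions U"
proof -
  have "(deriv ^^ k) (\<lambda>x::real. 0::real) = (\<lambda>x. 0)" for k
    by (induction k) (auto intro!: DERIV_imp_deriv)
  then show ?thesis by (intro test_functionsI[of _ "{}"]) (auto simp: smooth_def)
qed

text \<open>
  The complement of the closed support is open, so all derivatives vanish there along with the
  function. This makes the boundary terms in integrations by parts vanish.
\<close>

lemma deriv_zero_outside_support:
  assumes "x \<notin> closure {x. f x \<noteq> 0}"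
  shows "(deriv ^^ k) f x = (0::real)"
  using assms
proof (induction k arbitrary: x)
  case 0 then show ?case using closure_subset[of "{x. f x \<noteq> 0}"] by auto
next
  case (Suc k)
  have "((\<lambda>x. 0::real) has_real_derivative 0) (at x)" by simp
  then have "((deriv ^^ k) f has_real_derivative 0) (at x)"
    using Suc by (elim has_field_derivative_transform_within_open[of _ _ _ "- closure {x. f x \<noteq> 0}"]) auto
  then show ?case by (simp add: DERIV_imp_deriv)
qed

section \<open>A smooth function that is flat at the origin\<close>

text \<open>
  For \<open>q = 1\<close> this is the standard smooth function \<open>exp (- 1 / x)\<close> on the positive half-line, extended
  by zero. Polynomials in \<open>1 / x\<close> as prefactors make the class closed under differentiation.
\<close>

definition bump_term :: "real poly \<Rightarrow> real \<Rightarrow> real" where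
  "bump_term q x = (if x > 0 then poly q (1 / x) * exp (- 1 / x) else 0)"

lemma poly_exp_limit: "((\<lambda>t::real. poly q t * exp (- t)) \<longlongrightarrow> 0) at_top"
proof -
  have "((\<lambda>t. \<Sum>i\<le>degree q. coeff q i * (t ^ i / exp t)) \<longlongrightarrow> (\<Sum>i\<le>degree q. coeff q i * 0)) at_top"
    by (intro tendsto_sum tendsto_mult tendsto_const tendsto_power_div_exp_0)
  then show ?thesis
    by (simp add: poly_altdef sum_distrib_right exp_minus divide_inverse mult.assoc)
qed

text \<open>
  At the origin the difference quotient from the right is of the form \<open>poly r t * exp (- t)\<close> with
  \<open>t = 1 / x\<close>, which tends to zero; the derivative therefore again belongs to the class, with value zero
  at the origin.
\<close>

lemma bump_term_has_deriv:
  "(bump_term q has_real_derivative bump_term ((q - pderiv q) * monom 1 2) x) (at x)"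
proof (cases x "0::real" rule: linorder_cases)
  case greater
  have "((\<lambda>x. poly q (1 / x) * exp (- 1 / x)) has_real_derivative
      bump_term ((q - pderiv q) * monom 1 2) x) (at x)"
    using greater
    by (auto intro!: derivative_eq_intros DERIV_chain2[OF poly_DERIV]
        simp: bump_term_def poly_monom field_simps power2_eq_square)
  then show ?thesis
    using greater
    by (elim has_field_derivative_transform_within_open[of _ _ _ "{0<..}"]) (auto simp: bump_term_def)
next
  case less
  have "((\<lambda>x. 0::real) has_real_derivative bump_term ((q - pderiv q) * monom 1 2) x) (at x)"
    using less by (simp add: bump_term_def)
  then show ?thesis
    using less by (elim has_field_derivative_transform_within_open[of _ _ _ "{..<0}"]) (auto simp: bump_term_def)
next
  case equal
  have "((\<lambda>h. bump_term q h / h) \<longlongrightarrow> 0) (at 0)"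
  proof (rule filterlim_split_at_real)
    have 0: "((\<lambda>h. poly (q * monom 1 1) (inverse h) * exp (- inverse h)) \<longlongrightarrow> (0::real)) (at_right 0)"
      by (rule filterlim_compose[OF poly_exp_limit filterlim_inverse_at_top_right])
    show "((\<lambda>h. bump_term q h / h) \<longlongrightarrow> 0) (at_right 0)"
      using 0 by (rule Lim_transform_eventually)
        (auto simp: eventually_at_filter bump_term_def poly_monom field_simps)
    show "((\<lambda>h. bump_term q h / h) \<longlongrightarrow> 0) (at_left 0)"
      by (rule Lim_transform_eventually[OF tendsto_const])
        (auto simp: eventually_at_filter bump_term_def)
  qed
  then show ?thesis
    using equal by (simp add: DERIV_def bump_term_def)
qed

lemma smooth_bump_term: "smooth (bump_term q)"
proof -
  have "\<exists>r. (deriv ^^ k) (bump_term q) = bump_term r" for k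
  proof (induction k)
    case (Suc k)
    then obtain r where "(deriv ^^ k) (bump_term q) = bump_term r" by blast
    then show ?case using DERIV_imp_deriv[OF bump_term_has_deriv, of r] by (metis comp_apply ext funpow.simps(2))
  qed auto
  then show ?thesis
    unfolding smooth_def by (metis bump_term_has_deriv real_differentiable_def)
qed

section \<open>Uniqueness of weak derivatives\<close>

lemma continuous_borel_measurable_lebesgue_on:
  fixes f :: "real \<Rightarrow> real"
  assumes "continuous_on UNIV f"
  shows "f \<in> borel_measurable (lebesgue_on S)"
  using assms by (intro measurable_restrict_space1 measurable_completion)
    (auto intro: borel_measurable_continuous_onI)

lemma AE_lebesgue_on_iff:
  assumes "S \<in> sets lebesgue"
  shows "(AE x in lebesgue_on S. P x) \<longleftrightarrow> (AE x in lebesgue. x \<in> S \<longrightarrow> P x)"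
  using assms by (intro AE_restrict_space_iff) auto

text \<open>
  The averages of \<open>g\<close> over small intervals \<open>[x, x + h]\<close> converge to \<open>g x\<close> for almost every \<open>x\<close>, and
  all of them vanish. As integrability is
  assumed only away from \<open>c\<close> and \<open>d\<close>, this is first done on compact subintervals, countably many of
  which exhaust the interval.
\<close>

lemma AE_zero_if_subinterval_integrals_zero:
  fixes g :: "real \<Rightarrow> real"
  assumes int: "\<And>s t. c < s \<Longrightarrow> s < t \<Longrightarrow> t < d \<Longrightarrow> integrable (lebesgue_on {s..t}) g"
    and zero: "\<And>s t. c < s \<Longrightarrow> s < t \<Longrightarrow> t < d \<Longrightarrow> (\<integral>x. g x \<partial>lebesgue_on {s..t}) = 0"
  shows "AE x in lebesgue_on {c<..<d}. g x = 0"
proof -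
  have local: "AE x in lebesgue. x \<in> {s<..<t} \<longrightarrow> g x = 0" if st: "c < s" "t < d" for s t
  proof (cases "s < t")
    case True
    define f where "f = (\<lambda>x. if x \<in> {s..t} then g x else 0)"
    have "integrable lebesgue f"
      unfolding f_def using int[OF st(1) True st(2)] by (subst Lebesgue_Measure.integrable_restrict_UNIV) auto
    then have fab: "f absolutely_integrable_on UNIV"
      by (simp add: set_integrable_def)
    have "f integrable_on cbox a b" for a b
      using fab by (meson absolutely_integrable_on_subcbox set_lebesgue_integral_eq_integral(1) subset_UNIV
          absolutely_integrable_on_def integrable_on_subcbox)
    then obtain N where N: "negligible N"
       "\<And>x e. \<lbrakk>x \<notin> N; 0 < e\<rbrakk> \<Longrightarrow> \<exists>\<delta>>0. \<forall>h. 0 < h \<and> h < \<delta> \<longrightarrow>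
            norm (integral (cbox x (x + h *\<^sub>R One)) f /\<^sub>R h ^ DIM(real) - f x) < e"
      using integrable_ccontinuous_explicit[of f] by metis
    have "g x = 0" if "x \<notin> N" "x \<in> {s<..<t}" for x
    proof (rule ccontr)
      assume "g x \<noteq> 0"
      then obtain \<delta> where \<delta>: "\<delta> > 0" "\<And>h. 0 < h \<Longrightarrow> h < \<delta> \<Longrightarrow>
          norm (integral (cbox x (x + h *\<^sub>R One)) f /\<^sub>R h ^ DIM(real) - f x) < \<bar>g x\<bar>"
        using N(2)[OF \<open>x \<notin> N\<close>, of "\<bar>g x\<bar>"] that by auto
      \<comment> \<open>small enough for the averages to be close to \<open>g x\<close> and for \<open>[x, x + h]\<close> to stay inside \<open>(s, t)\<close>\<close>
      define h where "h = min (\<delta> / 2) ((t - x) / 2)"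
      have h: "0 < h" "h < \<delta>" "x + h < t" using \<delta>(1) that by (auto simp: h_def min_def field_simps)
      have "integral {x..x + h} f = integral {x..x + h} g"
        using h that by (intro integral_cong) (auto simp: f_def)
      also have "\<dots> = (\<integral>x. g x \<partial>lebesgue_on {x..x + h})"
        using h that st by (intro lebesgue_integral_eq_integral[symmetric] int) auto
      also have "\<dots> = 0"
        using h that st by (intro zero) auto
      finally show False
        using \<delta>(2)[OF h(1,2)] that by (simp add: f_def)
    qed
    moreover have "AE x in lebesgue. x \<notin> N"
      using N(1) by (intro AE_not_in) (simp add: negligible_iff_null_sets)
    ultimately show ?thesis by (auto elim: eventually_mono)
  qed auto
  have "AE x in lebesgue. \<forall>n::nat. x \<in> {c + 1 / Suc n<..<d - 1 / Suc n} \<longrightarrow> g x = 0"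
    by (subst AE_all_countable) (intro allI local, auto)
  then have "AE x in lebesgue. x \<in> {c<..<d} \<longrightarrow> g x = 0"
  proof eventually_elim
    case (elim x)
    show ?case
    proof
      assume x: "x \<in> {c<..<d}"
      then obtain n where "inverse (real (Suc n)) < min (x - c) (d - x)"
        using reals_Archimedean[of "min (x - c) (d - x)"] by auto
      then show "g x = 0" using elim x by (auto simp: field_simps)
    qed
  qed
  then show ?thesis by (subst AE_lebesgue_on_iff) auto
qed

text \<open>
  Smooth functions with support in \<open>[s, t]\<close> that increase to the indicator function of \<open>(s, t)\<close>: the
  \<open>n\<close>-th one is the first one raised to the power \<open>1 / (n + 1)\<close>.
\<close>

definition bump :: "real \<Rightarrow> real \<Rightarrow> nat \<Rightarrow> real \<Rightarrow> real" where
  "bump s t n x = bump_term 1 (real (Suc n) * (x - s)) * bump_term 1 (real (Suc n) * (t - x))"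

lemma bump_eq_0: "x \<notin> {s<..<t} \<Longrightarrow> bump s t n x = 0"
  by (auto simp: bump_def bump_term_def zero_less_mult_iff)

lemma smooth_bump: "smooth (bump s t n)"
proof -
  have "smooth (\<lambda>x. bump_term 1 (real (Suc n) * x + (- (real (Suc n) * s))) *
      bump_term 1 (- real (Suc n) * x + real (Suc n) * t))"
    by (intro smooth_mult smooth_affine smooth_bump_term)
  also have "(\<lambda>x. bump_term 1 (real (Suc n) * x + (- (real (Suc n) * s))) *
      bump_term 1 (- real (Suc n) * x + real (Suc n) * t)) = bump s t n"
    unfolding bump_def by (intro ext arg_cong2[of _ _ _ _ "(*)"] arg_cong[of _ _ "bump_term 1"]) algebra+
  finally show ?thesis .
qed

lemma bump_test_function:
  assumes "c < s" "t < d"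
  shows "bump s t n \<in> test_functions {c<..<d}"
  using assms by (intro test_functionsI[OF smooth_bump, of "{s..t}"]) (auto intro: bump_eq_0)

lemma bump_bounds: "0 \<le> bump s t n x \<and> bump s t n x \<le> 1"
  unfolding bump_def bump_term_def by (auto intro!: mult_le_one simp: divide_le_0_iff)

lemma bump_tendsto_1:
  assumes "s < x" "x < t"
  shows "(\<lambda>n. bump s t n x) \<longlonglongrightarrow> 1"
proof -
  have *: "(\<lambda>n. bump_term 1 (real (Suc n) * y)) \<longlonglongrightarrow> 1" if "y > 0" for y
  proof -
    have "(\<lambda>n. exp (- (1 / y) * (1 / real (Suc n)))) \<longlonglongrightarrow> exp (- (1 / y) * 0)"
      by (intro tendsto_intros LIMSEQ_Suc lim_1_over_n)
    moreover have "exp (- (1 / y) * (1 / real (Suc n))) = bump_term 1 (real (Suc n) * y)" for n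
      using that by (simp add: bump_term_def zero_less_mult_iff mult.commute)
    ultimately show ?thesis by simp
  qed
  show ?thesis
    unfolding bump_def using tendsto_mult[OF *[of "x - s"] *[of "t - x"]] assms by simp
qed

lemma locally_integrable_on_Icc:
  assumes "locally_integrable_on v {c<..<d}" "c < s" "t < d"
  shows "integrable (lebesgue_on {s..t}) v"
proof -
  have "compact {s..t}" "{s..t} \<subseteq> {c<..<d}" using assms by auto
  then show ?thesis using assms(1) unfolding locally_integrable_on_def by blast
qed

lemma integral_bump_tendsto:
  assumes "c < s" "s < t" "t < d" "locally_integrable_on v {c<..<d}"
  shows "(\<lambda>n. \<integral>x. v x * bump s t n x \<partial>lebesgue_on {c<..<d}) \<longlonglongrightarrow> (\<integral>x. v x \<partial>lebesgue_on {s..t})"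
proof -
  have int: "integrable (lebesgue_on {s..t}) v"
    using assms by (intro locally_integrable_on_Icc)
  have [measurable]: "bump s t n \<in> borel_measurable (lebesgue_on {s..t})" for n
    using smooth_deriv_continuous[OF smooth_bump, where k=0]
    by (intro continuous_borel_measurable_lebesgue_on) auto
  have [measurable]: "v \<in> borel_measurable (lebesgue_on {s..t})"
    using int by auto
  have "(\<lambda>n. \<integral>x. v x * bump s t n x \<partial>lebesgue_on {s..t}) \<longlonglongrightarrow> (\<integral>x. v x \<partial>lebesgue_on {s..t})"
  proof (rule integral_dominated_convergence[where w="\<lambda>x. \<bar>v x\<bar>"])
    have "AE x in lebesgue. x \<notin> {s, t}"
      by (intro AE_not_in) (simp add: negligible_iff_null_sets[symmetric])
    then show "AE x in lebesgue_on {s..t}. (\<lambda>n. v x * bump s t n x) \<longlonglongrightarrow> v x"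
    proof (subst AE_lebesgue_on_iff, simp, eventually_elim)
      case (elim x)
      then show ?case using tendsto_mult_left[OF bump_tendsto_1[of s x t], of "v x"] by auto
    qed
    show "AE x in lebesgue_on {s..t}. norm (v x * bump s t n x) \<le> \<bar>v x\<bar>" for n
      using bump_bounds[of s t n] by (auto simp: abs_mult intro!: AE_I2 mult_left_le)
  qed (use int in auto)
  moreover have "(\<integral>x. v x * bump s t n x \<partial>lebesgue_on {c<..<d}) =
     (\<integral>x. v x * bump s t n x \<partial>lebesgue_on {s..t})" for n
  proof -
    have "(\<integral>x. v x * bump s t n x \<partial>lebesgue_on {c<..<d}) =
      (\<integral>x. (if x \<in> {s..t} then v x * bump s t n x else 0) \<partial>lebesgue_on {c<..<d})"
      by (intro Bochner_Integration.integral_cong) (auto simp: bump_eq_0)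
    also have "\<dots> = (\<integral>x. v x * bump s t n x \<partial>lebesgue_on {s..t})"
      using assms by (intro Lebesgue_Measure.integral_restrict) auto
    finally show ?thesis .
  qed
  ultimately show ?thesis by simp
qed

text \<open>
  Testing against the bump functions and passing to the limit by dominated convergence shows that the
  two weak derivatives have the same integral over every compact subinterval.
\<close>

lemma has_weak_deriv_unique:
  assumes "has_weak_deriv {c<..<d} k u v" "has_weak_deriv {c<..<d} k u v'"
  shows "AE x in lebesgue_on {c<..<d}. v x = v' x"
proof -
  have loc: "locally_integrable_on v {c<..<d}" "locally_integrable_on v' {c<..<d}"
    using assms by (auto simp: has_weak_deriv_def)
  have eq: "(\<integral>x. v x * \<phi> x \<partial>lebesgue_on {c<..<d}) = (\<integral>x. v' x * \<phi> x \<partial>lebesgue_on {c<..<d})"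
    if "\<phi> \<in> test_functions {c<..<d}" for \<phi>
    using assms that by (force simp: has_weak_deriv_def)
  have "AE x in lebesgue_on {c<..<d}. v x - v' x = 0"
  proof (rule AE_zero_if_subinterval_integrals_zero)
    fix s t assume st: "c < s" "s < t" "t < d"
    have int: "integrable (lebesgue_on {s..t}) v" "integrable (lebesgue_on {s..t}) v'"
      using loc st by (auto intro: locally_integrable_on_Icc)
    then show "integrable (lebesgue_on {s..t}) (\<lambda>x. v x - v' x)" by simp
    have "(\<integral>x. v x \<partial>lebesgue_on {s..t}) = (\<integral>x. v' x \<partial>lebesgue_on {s..t})"
      using integral_bump_tendsto[OF st loc(1)] integral_bump_tendsto[OF st loc(2)]
      unfolding eq[OF bump_test_function[OF st(1,3)]] by (rule LIMSEQ_unique)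
    then show "(\<integral>x. v x - v' x \<partial>lebesgue_on {s..t}) = 0" using int by simp
  qed
  then show ?thesis by simp
qed

section \<open>A Hardy inequality\<close>

definition C1 :: "(real \<Rightarrow> real) \<Rightarrow> (real \<Rightarrow> real) \<Rightarrow> bool" where
  "C1 g g' \<longleftrightarrow> (\<forall>x. (g has_real_derivative g' x) (at x)) \<and> continuous_on UNIV g'"

lemma C1_continuous:
  assumes "C1 g g'"
  shows "continuous_on S g" "continuous_on S g'"
  using assms unfolding C1_def
  by (meson DERIV_isCont continuous_at_imp_continuous_on, meson continuous_on_subset subset_UNIV)

lemma integral_mono_set:
  fixes f :: "real \<Rightarrow> real"
  assumes "continuous_on {r..t} f" "\<And>x. x \<in> {r..t} \<Longrightarrow> 0 \<le> f x" "{p..q} \<subseteq> {r..t}"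
  shows "integral {p..q} f \<le> integral {r..t} f"
  using assms by (intro integral_subset_le integrable_continuous_interval)
    (auto intro: continuous_on_subset)

lemma oscillation_le_integral_deriv:
  assumes "C1 g g'" "x \<le> y"
  shows "\<bar>g y - g x\<bar> \<le> integral {x..y} (\<lambda>t. \<bar>g' t\<bar>)"
proof -
  have "(g' has_integral (g y - g x)) {x..y}"
    using assms by (intro fundamental_theorem_of_calculus)
      (auto simp: C1_def has_real_derivative_iff_has_vector_derivative intro: has_vector_derivative_at_within)
  then have "g y - g x = integral {x..y} g'" by (simp add: integral_unique)
  moreover have "norm (integral {x..y} g') \<le> integral {x..y} (\<lambda>t. \<bar>g' t\<bar>)"
    using C1_continuous[OF assms(1)]
    by (intro integral_norm_bound_integral integrable_continuous_interval) (auto intro!: continuous_intros)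
  ultimately show ?thesis by simp
qed

text \<open>
  Integrate the derivative of \<open>x ^ (e + 1) * F x\<close> over \<open>[0, L]\<close>, where \<open>F x\<close> is the integral of \<open>f\<close>
  over \<open>[x, L]\<close>: the boundary terms vanish because of the power at \<open>0\<close> and because \<open>F L = 0\<close>.
\<close>

lemma hardy_tail:
  fixes f :: "real \<Rightarrow> real"
  assumes "continuous_on UNIV f" "0 \<le> L"
  shows "integral {0..L} (\<lambda>x. x ^ e * integral {x..L} f) =
    integral {0..L} (\<lambda>x. x ^ Suc e * f x) / real (Suc e)"
proof -
  define F where "F = (\<lambda>x. integral {x..L} f)"
  have cont: "continuous_on S f" for S using assms(1) continuous_on_subset by blast
  have F_alt: "F x = integral {0..L} f - integral {0..x} f" if "x \<in> {0..L}" for x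
    using Henstock_Kurzweil_Integration.integral_combine[of 0 x L f] that integrable_continuous_interval[OF cont]
    by (auto simp: F_def)
  have "((\<lambda>x. integral {0..x} f) has_real_derivative f x) (at x within {0..L})" if "x \<in> {0..L}" for x
    using that cont by (intro integral_has_real_derivative) auto
  then have "((\<lambda>x. integral {0..L} f - integral {0..x} f) has_real_derivative - f x) (at x within {0..L})" if "x \<in> {0..L}" for x
    using that by (auto intro!: derivative_eq_intros)
  then have F: "(F has_real_derivative - f x) (at x within {0..L})" if "x \<in> {0..L}" for x
    using that F_alt
    by (intro has_field_derivative_transform_within[of "\<lambda>x. integral {0..L} f - integral {0..x} f" _ x "{0..L}" 1 F]) auto
  have contF: "continuous_on {0..L} F"
    by (meson DERIV_continuous F continuous_on_eq_continuous_within)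
  have "((\<lambda>x. real (Suc e) * (x ^ e * F x) - x ^ Suc e * f x) has_integral (L ^ Suc e * F L - 0 ^ Suc e * F 0)) {0..L}"
  proof (rule fundamental_theorem_of_calculus[OF assms(2)])
    fix x assume x: "x \<in> {0..L}"
    have "((\<lambda>x. x ^ Suc e * F x) has_real_derivative real (Suc e) * (x ^ e * F x) - x ^ Suc e * f x) (at x within {0..L})"
      using DERIV_mult'[OF DERIV_pow[of "Suc e"] F[OF x]] by (simp add: algebra_simps)
    then show "((\<lambda>x. x ^ Suc e * F x) has_vector_derivative real (Suc e) * (x ^ e * F x) - x ^ Suc e * f x) (at x within {0..L})"
      by (simp add: has_real_derivative_iff_has_vector_derivative)
  qed
  moreover have "F L = 0" by (simp add: F_def)
  ultimately have "((\<lambda>x. real (Suc e) * (x ^ e * F x) - x ^ Suc e * f x) has_integral 0) {0..L}"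
    by simp
  then have "0 = integral {0..L} (\<lambda>x. real (Suc e) * (x ^ e * F x) - x ^ Suc e * f x)"
    by (simp add: integral_unique)
  also have "\<dots> = integral {0..L} (\<lambda>x. real (Suc e) * (x ^ e * F x)) - integral {0..L} (\<lambda>x. x ^ Suc e * f x)"
    using contF cont by (intro Henstock_Kurzweil_Integration.integral_diff integrable_continuous_interval continuous_intros)
  also have "integral {0..L} (\<lambda>x. real (Suc e) * (x ^ e * F x)) = real (Suc e) * integral {0..L} (\<lambda>x. x ^ e * F x)"
    by (rule Henstock_Kurzweil_Integration.integral_mult_right)
  finally show ?thesis unfolding F_def by (simp add: field_simps)
qed

text \<open>
  On the outer half of the interval the powers \<open>x ^ e\<close> and \<open>x ^ j\<close> are comparable. On the inner half
  \<open>\<bar>g x\<bar>\<close> is at most \<open>\<bar>g y\<bar>\<close> plus the integral of \<open>\<bar>g'\<bar>\<close> over \<open>[x, L]\<close>, for any \<open>y\<close> in the outer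
  half; if \<open>y\<close> minimises \<open>\<bar>g\<bar>\<close> there, \<open>\<bar>g y\<bar>\<close> is bounded by the weighted integral of \<open>\<bar>g\<bar>\<close>, and the
  other term is computed by \<open>hardy_tail\<close>.
\<close>

lemma hardy_one_sided:
  assumes "0 \<le> L" "e' \<le> Suc e"
  obtains C where "0 \<le> C" "\<And>g g'. C1 g g' \<Longrightarrow>
    integral {0..L} (\<lambda>x. x ^ e * \<bar>g x\<bar>) \<le>
      C * (integral {0..L} (\<lambda>x. x ^ j * \<bar>g x\<bar>) + integral {0..L} (\<lambda>x. x ^ e' * \<bar>g' x\<bar>))"
proof (cases "L = 0")
  case True
  then show ?thesis by (intro that[of 0]) auto
next
  case False
  then have L: "L > 0" using assms by simp
  define R where "R = L / 2"
  have R: "0 < R" "R < L" "L - R = R" using L by (auto simp: R_def)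
  \<comment> \<open>\<open>A\<close> compares the weights on the outer half, \<open>B\<close> bounds the contribution of \<open>\<bar>g y\<bar>\<close> on the inner half,
    and \<open>D\<close> compares the weight \<open>x ^ (e + 1)\<close> of the derivative with \<open>x ^ e'\<close>\<close>
  define A where "A = L ^ e / R ^ j"
  define B where "B = L ^ Suc e / (R * R ^ j)"
  define D where "D = L ^ (Suc e - e')"
  have nn: "0 \<le> A" "0 \<le> B" "0 \<le> D" using L R by (auto simp: A_def B_def D_def)
  show ?thesis
  proof (rule that[of "A + B + D"])
    fix g g' assume C1: "C1 g g'"
    note cont = C1_continuous[OF C1]
    note icont = integrable_continuous_interval
    define I1 where "I1 = integral {0..L} (\<lambda>x. x ^ j * \<bar>g x\<bar>)"
    define I2 where "I2 = integral {0..L} (\<lambda>x. x ^ e' * \<bar>g' x\<bar>)"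
    define G where "G = (\<lambda>x. integral {x..L} (\<lambda>t. \<bar>g' t\<bar>))"
    have I_nn: "0 \<le> I1" "0 \<le> I2" unfolding I1_def I2_def
      by (intro integral_nonneg icont continuous_intros cont; simp)+
    have far: "integral {R..L} (\<lambda>x. x ^ j * \<bar>g x\<bar>) \<le> I1"
      unfolding I1_def using R by (intro integral_mono_set continuous_intros cont) auto
    have contG: "continuous_on {0..L} G"
      unfolding G_def by (intro indefinite_integral_continuous_1' icont continuous_intros cont)
    have "integral {R..L} (\<lambda>x. x ^ e * \<bar>g x\<bar>) \<le> integral {R..L} (\<lambda>x. A * (x ^ j * \<bar>g x\<bar>))"
    proof (intro integral_le icont continuous_intros cont)
      fix x assume x: "x \<in> {R..L}"
      have "x ^ e * R ^ j \<le> L ^ e * x ^ j"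
        using x R by (intro mult_mono power_mono) auto
      then have "x ^ e \<le> A * x ^ j" using R by (simp add: A_def field_simps)
      then show "x ^ e * \<bar>g x\<bar> \<le> A * (x ^ j * \<bar>g x\<bar>)"
        by (metis abs_ge_zero mult.assoc mult_right_mono)
    qed
    also have "\<dots> \<le> A * I1" using far nn by (simp add: mult_left_mono)
    finally have 1: "integral {R..L} (\<lambda>x. x ^ e * \<bar>g x\<bar>) \<le> A * I1" .
    have "\<exists>y\<in>{R..L}. \<forall>x\<in>{R..L}. \<bar>g y\<bar> \<le> \<bar>g x\<bar>"
      using R by (intro continuous_attains_inf continuous_intros cont) auto
    then obtain y where y: "y \<in> {R..L}" "\<And>x. x \<in> {R..L} \<Longrightarrow> \<bar>g y\<bar> \<le> \<bar>g x\<bar>"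
      by blast
    \<comment> \<open>the outer half has length \<open>R\<close>, and \<open>x ^ j \<ge> R ^ j\<close> on it\<close>
    have "R * (R ^ j * \<bar>g y\<bar>) = integral {R..L} (\<lambda>x. R ^ j * \<bar>g y\<bar>)" using R by simp
    also have "\<dots> \<le> integral {R..L} (\<lambda>x. x ^ j * \<bar>g x\<bar>)"
      using R y by (intro integral_le icont continuous_intros cont mult_mono power_mono) auto
    finally have gy: "\<bar>g y\<bar> \<le> I1 / (R * R ^ j)" using far R by (simp add: field_simps)
    have "integral {0..R} (\<lambda>x. x ^ e * \<bar>g x\<bar>) \<le> integral {0..R} (\<lambda>x. L ^ e * \<bar>g y\<bar> + x ^ e * G x)"
    proof (intro integral_le icont continuous_intros cont continuous_on_subset[OF contG])
      fix x assume x: "x \<in> {0..R}"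
      have "\<bar>g y - g x\<bar> \<le> integral {x..y} (\<lambda>t. \<bar>g' t\<bar>)"
        using x y by (intro oscillation_le_integral_deriv C1) auto
      also have "\<dots> \<le> G x" unfolding G_def
        using y by (intro integral_mono_set continuous_intros cont) auto
      finally have "\<bar>g x\<bar> \<le> \<bar>g y\<bar> + G x" by linarith
      then have "x ^ e * \<bar>g x\<bar> \<le> x ^ e * (\<bar>g y\<bar> + G x)" using x by (intro mult_left_mono) auto
      moreover have "x ^ e * \<bar>g y\<bar> \<le> L ^ e * \<bar>g y\<bar>" using x R by (intro mult_right_mono power_mono) auto
      ultimately show "x ^ e * \<bar>g x\<bar> \<le> L ^ e * \<bar>g y\<bar> + x ^ e * G x" by (simp add: algebra_simps)
    qed (use R in auto)
    also have "\<dots> = R * (L ^ e * \<bar>g y\<bar>) + integral {0..R} (\<lambda>x. x ^ e * G x)"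
      using R by (subst Henstock_Kurzweil_Integration.integral_add)
       (auto intro!: icont continuous_intros continuous_on_subset[OF contG])
    also have "R * (L ^ e * \<bar>g y\<bar>) \<le> L * (L ^ e * (I1 / (R * R ^ j)))"
      using R gy by (intro mult_mono) auto
    also have "\<dots> = B * I1" by (simp add: B_def)
    also have "integral {0..R} (\<lambda>x. x ^ e * G x) \<le> integral {0..L} (\<lambda>x. x ^ e * G x)"
      using R by (intro integral_mono_set continuous_intros contG)
        (auto simp: G_def intro!: mult_nonneg_nonneg integral_nonneg icont continuous_intros cont)
    also have "\<dots> = integral {0..L} (\<lambda>x. x ^ Suc e * \<bar>g' x\<bar>) / real (Suc e)"
      unfolding G_def using L by (intro hardy_tail continuous_intros cont) auto
    also have "\<dots> \<le> integral {0..L} (\<lambda>x. x ^ Suc e * \<bar>g' x\<bar>)"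
    proof -
      have "0 \<le> integral {0..L} (\<lambda>x. x ^ Suc e * \<bar>g' x\<bar>)"
        by (intro integral_nonneg icont continuous_intros cont) auto
      then show ?thesis by (simp add: field_simps)
    qed
    also have "\<dots> \<le> integral {0..L} (\<lambda>x. D * (x ^ e' * \<bar>g' x\<bar>))"
    proof (intro integral_le icont continuous_intros cont)
      fix x assume x: "x \<in> {0..L}"
      \<comment> \<open>a smaller power of the distance gives a larger integrand, up to powers of \<open>L\<close>\<close>
      have "x ^ Suc e = x ^ (Suc e - e') * x ^ e'" using assms by (simp flip: power_add)
      also have "\<dots> \<le> D * x ^ e'" unfolding D_def using x by (intro mult_right_mono power_mono) auto
      finally show "x ^ Suc e * \<bar>g' x\<bar> \<le> D * (x ^ e' * \<bar>g' x\<bar>)"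
        by (metis abs_ge_zero mult.assoc mult_right_mono)
    qed
    also have "\<dots> = D * I2" by (simp add: I2_def)
    finally have 2: "integral {0..R} (\<lambda>x. x ^ e * \<bar>g x\<bar>) \<le> B * I1 + D * I2" by simp
    have "integral {0..L} (\<lambda>x. x ^ e * \<bar>g x\<bar>) =
      integral {0..R} (\<lambda>x. x ^ e * \<bar>g x\<bar>) + integral {R..L} (\<lambda>x. x ^ e * \<bar>g x\<bar>)"
      using R by (intro Henstock_Kurzweil_Integration.integral_combine[symmetric] icont continuous_intros cont) auto
    also have "\<dots> \<le> (A + B) * I1 + D * I2" using 1 2 by (simp add: algebra_simps)
    also have "\<dots> \<le> (A + B + D) * I1 + (A + B + D) * I2"
      using mult_right_mono[of "A + B" "A + B + D" I1] mult_right_mono[of D "A + B + D" I2] nn I_nn by linarith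
    finally show "integral {0..L} (\<lambda>x. x ^ e * \<bar>g x\<bar>) \<le> (A + B + D) *
      (integral {0..L} (\<lambda>x. x ^ j * \<bar>g x\<bar>) + integral {0..L} (\<lambda>x. x ^ e' * \<bar>g' x\<bar>))"
      unfolding I1_def I2_def by (simp add: algebra_simps)
  qed (use nn in auto)
qed

lemma integral_two_sided:
  fixes f :: "real \<Rightarrow> real"
  assumes "continuous_on UNIV f" "c \<le> x0" "x0 \<le> d"
  shows "integral {c..d} f = integral {0..d - x0} (\<lambda>s. f (x0 + s)) + integral {0..x0 - c} (\<lambda>s. f (x0 - s))"
proof -
  have cont: "continuous_on S f" for S using assms(1) continuous_on_subset by blast
  have int: "(f has_integral integral {p..q} f) (cbox p q)" for p q
    using integrable_continuous_interval[OF cont] by (simp add: integrable_integral)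
  have "((\<lambda>s. f (x0 + s)) has_integral integral {x0..d} f) {0..d - x0}"
    using has_integral_affinity[OF int[of x0 d], of 1 x0]
    by (simp only: scaleR_one div_by_1 abs_one power_one real_scaleR_def mult_1 diff_conv_add_uminus[symmetric]
        image_minus_const_atLeastAtMost' cbox_interval add.commute[of _ x0] diff_self)
  then have 1: "integral {x0..d} f = integral {0..d - x0} (\<lambda>s. f (x0 + s))"
    by (rule integral_unique[symmetric])
  have "((\<lambda>s. f (x0 - s)) has_integral integral {c..x0} f) {0..x0 - c}"
    using has_integral_affinity[OF int[of c x0], of "-1" x0] by simp
  then have 2: "integral {c..x0} f = integral {0..x0 - c} (\<lambda>s. f (x0 - s))"
    by (rule integral_unique[symmetric])
  have "integral {c..x0} f + integral {x0..d} f = integral {c..d} f"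
    by (rule Henstock_Kurzweil_Integration.integral_combine[OF assms(2,3) integrable_continuous_interval[OF cont]])
  then show ?thesis unfolding 1 2 by linarith
qed

text \<open>
  Both sides of \<open>x0\<close> are reduced to \<open>hardy_one_sided\<close> by the substitutions \<open>x = x0 + s\<close> and
  \<open>x = x0 - s\<close>. If \<open>x0\<close> is an end point, one of the two pieces degenerates to a point.
\<close>

lemma hardy:
  assumes "c \<le> x0" "x0 \<le> d" "e' \<le> Suc e"
  obtains C where "0 \<le> C" "\<And>g g'. C1 g g' \<Longrightarrow>
    integral {c..d} (\<lambda>x. \<bar>x - x0\<bar> ^ e * \<bar>g x\<bar>) \<le>
      C * (integral {c..d} (\<lambda>x. \<bar>x - x0\<bar> ^ j * \<bar>g x\<bar>) + integral {c..d} (\<lambda>x. \<bar>x - x0\<bar> ^ e' * \<bar>g' x\<bar>))"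
proof -
  obtain A where A: "0 \<le> A" "\<And>g g'. C1 g g' \<Longrightarrow> integral {0..d - x0} (\<lambda>x. x ^ e * \<bar>g x\<bar>) \<le>
      A * (integral {0..d - x0} (\<lambda>x. x ^ j * \<bar>g x\<bar>) + integral {0..d - x0} (\<lambda>x. x ^ e' * \<bar>g' x\<bar>))"
    by (rule hardy_one_sided[of "d - x0" e' e j]) (use assms in auto)
  obtain B where B: "0 \<le> B" "\<And>g g'. C1 g g' \<Longrightarrow> integral {0..x0 - c} (\<lambda>x. x ^ e * \<bar>g x\<bar>) \<le>
      B * (integral {0..x0 - c} (\<lambda>x. x ^ j * \<bar>g x\<bar>) + integral {0..x0 - c} (\<lambda>x. x ^ e' * \<bar>g' x\<bar>))"
    by (rule hardy_one_sided[of "x0 - c" e' e j]) (use assms in auto)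
  show ?thesis
  proof (rule that[of "A + B"])
    fix g g' assume C1: "C1 g g'"
    note cont = C1_continuous[OF C1]
    have pr: "C1 (\<lambda>s. g (x0 + s)) (\<lambda>s. g' (x0 + s))"
    proof -
      have "((\<lambda>s. g (x0 + s)) has_real_derivative g' (x0 + x)) (at x)" for x
      proof -
        have "((\<lambda>s. x0 + s) has_real_derivative 1) (at x)" by (auto intro!: derivative_eq_intros)
        then show ?thesis using C1 DERIV_chain2[of g "g' (x0 + x)" "\<lambda>s. x0 + s" x 1 UNIV] by (simp add: C1_def)
      qed
      moreover have "continuous_on UNIV (\<lambda>s. g' (x0 + s))"
        by (rule continuous_on_compose2[OF cont(2)[of UNIV]]) (auto intro: continuous_intros)
      ultimately show ?thesis unfolding C1_def by blast
    qed
    have pl: "C1 (\<lambda>s. g (x0 - s)) (\<lambda>s. - g' (x0 - s))"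
    proof -
      have "((\<lambda>s. g (x0 - s)) has_real_derivative - g' (x0 - x)) (at x)" for x
      proof -
        have "((\<lambda>s. x0 - s) has_real_derivative -1) (at x)" by (auto intro!: derivative_eq_intros)
        then show ?thesis using C1 DERIV_chain2[of g "g' (x0 - x)" "\<lambda>s. x0 - s" x "-1" UNIV] by (simp add: C1_def)
      qed
      moreover have "continuous_on UNIV (\<lambda>s. - g' (x0 - s))"
        by (intro continuous_on_minus continuous_on_compose2[OF cont(2)[of UNIV]]) (auto intro: continuous_intros)
      ultimately show ?thesis unfolding C1_def by blast
    qed
    have two: "integral {c..d} (\<lambda>x. \<bar>x - x0\<bar> ^ i * \<bar>h x\<bar>) =
        integral {0..d - x0} (\<lambda>s. s ^ i * \<bar>h (x0 + s)\<bar>) + integral {0..x0 - c} (\<lambda>s. s ^ i * \<bar>h (x0 - s)\<bar>)"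
      if "continuous_on UNIV h" for h i
    proof (subst integral_two_sided[OF _ assms(1,2)])
      show "continuous_on UNIV (\<lambda>x. \<bar>x - x0\<bar> ^ i * \<bar>h x\<bar>)" by (intro continuous_intros that)
    qed (intro arg_cong2[of _ _ _ _ "(+)"] Henstock_Kurzweil_Integration.integral_cong; simp)
    have nn: "0 \<le> integral {0..b} (\<lambda>x. x ^ i * \<bar>h (x0 + x)\<bar>)" "0 \<le> integral {0..b} (\<lambda>x. x ^ i * \<bar>h (x0 - x)\<bar>)"
      if "continuous_on UNIV h" for b h i
    proof -
      have *: "continuous_on {0..b} (\<lambda>x. h (x0 + x))" "continuous_on {0..b} (\<lambda>x. h (x0 - x))"
        by (rule continuous_on_compose2[OF that]; auto intro: continuous_intros)+
      show "0 \<le> integral {0..b} (\<lambda>x. x ^ i * \<bar>h (x0 + x)\<bar>)" "0 \<le> integral {0..b} (\<lambda>x. x ^ i * \<bar>h (x0 - x)\<bar>)"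
        by (intro integral_nonneg integrable_continuous_interval continuous_on_mult continuous_on_power
            continuous_on_rabs continuous_on_id *; simp)+
    qed
    note cc = cont[of UNIV]
    have mono: "r * s \<le> (A + B) * s" if "r \<le> A + B" "0 \<le> s" for r s
      using that by (rule mult_right_mono)
    have "integral {0..d - x0} (\<lambda>x. x ^ e * \<bar>g (x0 + x)\<bar>) \<le>
      (A + B) * (integral {0..d - x0} (\<lambda>x. x ^ j * \<bar>g (x0 + x)\<bar>) + integral {0..d - x0} (\<lambda>x. x ^ e' * \<bar>g' (x0 + x)\<bar>))"
      by (rule order_trans[OF A(2)[OF pr] mono]) (use B nn[OF cc(1)] nn[OF cc(2)] in simp_all)
    moreover have "integral {0..x0 - c} (\<lambda>x. x ^ e * \<bar>g (x0 - x)\<bar>) \<le>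
      (A + B) * (integral {0..x0 - c} (\<lambda>x. x ^ j * \<bar>g (x0 - x)\<bar>) + integral {0..x0 - c} (\<lambda>x. x ^ e' * \<bar>g' (x0 - x)\<bar>))"
      using order_trans[OF B(2)[OF pl] mono] A(1) nn[OF cc(1)] nn[OF cc(2)] by simp
    ultimately show "integral {c..d} (\<lambda>x. \<bar>x - x0\<bar> ^ e * \<bar>g x\<bar>) \<le>
      (A + B) * (integral {c..d} (\<lambda>x. \<bar>x - x0\<bar> ^ j * \<bar>g x\<bar>) + integral {c..d} (\<lambda>x. \<bar>x - x0\<bar> ^ e' * \<bar>g' x\<bar>))"
      unfolding two[OF cc(1)] two[OF cc(2)] by (simp add: algebra_simps)
  qed (use A B in auto)
qed

section \<open>Hoelder bounds at noncritical points\<close>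

lemma integrable_lebesgue_on_subset:
  fixes f :: "real \<Rightarrow> real"
  assumes "integrable (lebesgue_on S) f" "T \<subseteq> S" "T \<in> sets lebesgue" "S \<in> sets lebesgue"
  shows "integrable (lebesgue_on T) f"
  using assms set_integrable_subset[of lebesgue S f T]
  by (simp add: set_integrable_def integrable_restrict_space)

lemma integral_lebesgue_on_mono_set:
  fixes f :: "real \<Rightarrow> real"
  assumes "integrable (lebesgue_on S) f" "T \<subseteq> S" "T \<in> sets lebesgue" "S \<in> sets lebesgue"
    "\<And>x. x \<in> S \<Longrightarrow> 0 \<le> f x"
  shows "(\<integral>x. f x \<partial>lebesgue_on T) \<le> (\<integral>x. f x \<partial>lebesgue_on S)"
proof -
  have "set_lebesgue_integral lebesgue T f \<le> set_lebesgue_integral lebesgue S f"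
    using assms integrable_lebesgue_on_subset[OF assms(1-4)]
    unfolding set_lebesgue_integral_def
    by (intro integral_mono) (auto simp: integrable_restrict_space indicator_def)
  then show ?thesis using assms by (simp add: integral_restrict_space set_lebesgue_integral_def)
qed

lemma continuous_integrable_Ioo:
  fixes f :: "real \<Rightarrow> real"
  assumes "continuous_on UNIV f"
  shows "integrable (lebesgue_on {c<..<d}) f"
    and "(\<integral>x. f x \<partial>lebesgue_on {c<..<d}) = integral {c..d} f"
proof -
  have "integrable (lebesgue_on {c..d}) f"
    using assms continuous_on_subset by (intro continuous_imp_integrable_real) blast
  then show *: "integrable (lebesgue_on {c<..<d}) f"
    by (rule integrable_lebesgue_on_subset) auto
  show "(\<integral>x. f x \<partial>lebesgue_on {c<..<d}) = integral {c..d} f"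
    by (subst lebesgue_integral_eq_integral[OF *]) (auto simp: integral_open_interval_real)
qed

lemma ball_Int_Ioo: "{a<..<b} \<inter> ball x \<epsilon> = {max a (x - \<epsilon>)<..<min b (x + \<epsilon>)}" for a b x :: real
  by (auto simp: ball_eq_greaterThanLessThan)

lemma dist_power_of_nat: "dist_power (real j) x0 x = \<bar>x - x0\<bar> ^ j"
  by (cases "j = 0"; cases "x = x0") (auto simp: dist_power_def powr_realpow)

text \<open>
  A crude Young inequality, without the factors \<open>1 / p\<close> and \<open>1 / p'\<close>: whichever of the two powers is
  larger dominates the product. It is as good as the sharp one for \<open>scaling_bound\<close>.
\<close>

lemma le_powr_add:
  fixes A B p :: real
  assumes "0 \<le> A" "0 \<le> B" "1 < p"
  shows "A * B \<le> A powr (p / (p - 1)) + B powr p"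
proof (cases "B powr p \<le> A powr (p / (p - 1))")
  case True
  have "B = (B powr p) powr (1 / p)" using assms by (simp add: powr_powr)
  also have "\<dots> \<le> (A powr (p / (p - 1))) powr (1 / p)" using True assms by (intro powr_mono2) auto
  also have "\<dots> = A powr (1 / (p - 1))" using assms by (simp add: powr_powr)
  finally have "A * B \<le> A powr 1 * A powr (1 / (p - 1))" using assms by (simp add: mult_left_mono)
  also have "\<dots> = A powr (p / (p - 1))"
  proof -
    have "1 + 1 / (p - 1) = p / (p - 1)" using assms by (simp add: field_simps)
    then show ?thesis by (metis powr_add)
  qed
  finally show ?thesis using powr_ge_zero[of B p] by linarith
next
  case False
  have "A = (A powr (p / (p - 1))) powr ((p - 1) / p)" using assms by (simp add: powr_powr)
  also have "\<dots> \<le> (B powr p) powr ((p - 1) / p)" using False assms by (intro powr_mono2) auto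
  also have "\<dots> = B powr (p - 1)" using assms by (simp add: powr_powr)
  finally have "A * B \<le> B powr (p - 1) * B powr 1" using assms by (simp add: mult_right_mono)
  also have "\<dots> = B powr p" using powr_add[of B "p - 1" 1] by simp
  finally show ?thesis using powr_ge_zero[of A "p / (p - 1)"] by linarith
qed

text \<open>
  The standard passage from an additive Young bound to a multiplicative Hoelder bound by homogeneity,
  with \<open>t\<close> chosen such that \<open>t powr p * P = 1\<close>. If \<open>P = 0\<close>, letting \<open>t\<close> grow forces \<open>J = 0\<close>.
\<close>

lemma scaling_bound:
  fixes J P K p :: real
  assumes p: "1 \<le> p" and "0 \<le> J" "0 \<le> P" "0 \<le> K" "\<And>t. t > 0 \<Longrightarrow> t * J \<le> K + t powr p * P"
  shows "J \<le> (K + 1) * P powr (1 / p)"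
proof (cases "P = 0")
  case True
  have "J \<le> 0"
  proof (rule ccontr)
    assume "\<not> J \<le> 0"
    then show False using assms(5)[of "(K + 1) / J"] True assms by (simp add: field_simps split: if_splits)
  qed
  then show ?thesis using True by simp
next
  case False
  then have P: "P > 0" using assms by simp
  define t where "t = P powr (- 1 / p)"
  have "t powr p = P powr (-1)" using p by (simp add: t_def powr_powr)
  then have "t powr p * P = 1" using P by (simp add: powr_minus)
  then have "t * J \<le> K + 1" using assms(5)[of t] P by (simp add: t_def)
  moreover have "t * P powr (1 / p) = 1" using P by (simp add: t_def powr_add[symmetric])
  moreover have "t * J * P powr (1 / p) \<le> (K + 1) * P powr (1 / p)"
    using \<open>t * J \<le> K + 1\<close> by (intro mult_right_mono) auto
  moreover have "t * J * P powr (1 / p) = (t * P powr (1 / p)) * J" by (simp only: mult_ac)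
  ultimately show ?thesis by simp
qed

context
  fixes a b p :: real and w :: "real \<Rightarrow> real"
  assumes w: "weight_on a b w" and p: "1 \<le> p"
begin

lemma weight_measurable: "w \<in> borel_measurable (lebesgue_on {a<..<b})"
  using w by (auto simp: weight_on_def)

lemma weight_nonneg: "AE x in lebesgue_on {a<..<b}. 0 \<le> w x"
  using w by (auto simp: weight_on_def)

lemma space_weight_measure: "space (weight_measure a b w) = {a<..<b}"
  by (simp add: weight_measure_def)

lemma measurable_weight_measure:
  "f \<in> borel_measurable (weight_measure a b w) \<longleftrightarrow> f \<in> borel_measurable (lebesgue_on {a<..<b})"
  by (simp add: weight_measure_def)

lemma finite_weight_measure: "finite_measure (weight_measure a b w)"
proof
  have "(\<integral>\<^sup>+x. ennreal (w x) \<partial>lebesgue_on {a<..<b}) < \<infinity>"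
    using w integrableD(2)[of "lebesgue_on {a<..<b}" w] unfolding weight_on_def
    by (subst nn_integral_cong[where v="\<lambda>x. ennreal (norm (w x))"])
       (auto simp: integrable_iff_bounded)
  then show "emeasure (weight_measure a b w) (space (weight_measure a b w)) \<noteq> \<infinity>"
    using weight_measurable unfolding space_weight_measure
    by (simp add: weight_measure_def emeasure_density)
       (metis (no_types, lifting) ennreal_mult_top infinity_ennreal_def less_irrefl mult.right_neutral nn_integral_cong
        indicator_simps(1) space_lebesgue_on)
qed

lemma continuous_in_Lp:
  assumes "continuous_on UNIV f"
  shows "f \<in> Lp_space (weight_measure a b w) p"
proof -
  interpret finite_measure "weight_measure a b w" by (rule finite_weight_measure)
  have "bounded (f ` {a..b})"
    using assms continuous_on_subset by (intro compact_imp_bounded compact_continuous_image) blast+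
  then obtain B where "\<forall>y\<in>f ` {a..b}. norm y \<le> B"
    unfolding bounded_iff by blast
  then have B: "\<bar>f x\<bar> \<le> B" if "x \<in> {a..b}" for x
    using that by simp
  have f: "f \<in> borel_measurable (weight_measure a b w)"
    using continuous_borel_measurable_lebesgue_on[OF assms] measurable_weight_measure by blast
  have "integrable (weight_measure a b w) (\<lambda>x. \<bar>f x\<bar> powr p)"
  proof (rule integrable_const_bound[where B="B powr p"])
    \<comment> \<open>the weighted measure is finite and \<open>f\<close> is bounded on the bounded interval\<close>
    show "AE x in weight_measure a b w. norm (\<bar>f x\<bar> powr p) \<le> B powr p"
      using B p by (intro AE_I2) (auto simp: space_weight_measure intro!: powr_mono2)
  qed (use f in measurable)
  then show ?thesis using f by (simp add: Lp_space_def)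
qed

text \<open>
  Rewrites the \<open>p\<close>-th power of the weighted norm as a Lebesgue integral, so that it can be compared
  pointwise with integrands on subintervals.
\<close>

lemma Lp_integral_eq:
  assumes "f \<in> Lp_space (weight_measure a b w) p"
  shows "(\<integral>x. \<bar>f x\<bar> powr p \<partial>weight_measure a b w) = (\<integral>x. w x * \<bar>f x\<bar> powr p \<partial>lebesgue_on {a<..<b})"
    and "integrable (lebesgue_on {a<..<b}) (\<lambda>x. w x * \<bar>f x\<bar> powr p)"
proof -
  have f: "f \<in> borel_measurable (lebesgue_on {a<..<b})"
    using assms measurable_weight_measure by (auto simp: Lp_space_def)
  note [measurable] = f weight_measurable
  have fp: "(\<lambda>x. \<bar>f x\<bar> powr p) \<in> borel_measurable (lebesgue_on {a<..<b})" by measurable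
  show "(\<integral>x. \<bar>f x\<bar> powr p \<partial>weight_measure a b w) = (\<integral>x. w x * \<bar>f x\<bar> powr p \<partial>lebesgue_on {a<..<b})"
    unfolding weight_measure_def using integral_density[OF fp weight_measurable weight_nonneg] by simp
  show "integrable (lebesgue_on {a<..<b}) (\<lambda>x. w x * \<bar>f x\<bar> powr p)"
    using assms integrable_density[OF fp weight_measurable weight_nonneg]
    by (simp add: Lp_space_def weight_measure_def)
qed

text \<open>
  By the Young inequality, \<open>\<bar>x - x0\<bar>^j \<bar>t f\<bar>\<close> is at most the integrand of the critical set condition
  plus \<open>w \<bar>t f\<bar>^p\<close>, and the former has a finite integral near \<open>x0\<close>; the scaling argument then yields
  the Hoelder bound. Since that integrand is infinite wherever \<open>w\<close> vanishes, except possibly at \<open>x0\<close>,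
  its integrability also gives positivity of \<open>w\<close>.
\<close>

lemma noncritical_bound_gt_1:
  assumes "1 < p" "x0 \<in> {a..b}" "x0 \<notin> critical_set a b w (real j) p"
  obtains \<epsilon> K where "\<epsilon> > 0" "0 \<le> K" "AE x in lebesgue_on ({a<..<b} \<inter> ball x0 \<epsilon>). 0 < w x"
    "\<And>f. continuous_on UNIV f \<Longrightarrow>
      (\<integral>x. \<bar>x - x0\<bar> ^ j * \<bar>f x\<bar> \<partial>lebesgue_on ({a<..<b} \<inter> ball x0 \<epsilon>)) \<le> K * Lp_norm (weight_measure a b w) p f"
proof -
  define q where "q = p / (p - 1)"
  define G where "G = (\<lambda>x. ennreal_powr (ennreal (dist_power (real j) x0 x) / ennreal (w x powr (1 / p))) q)"
  from assms obtain \<epsilon> where \<epsilon>: "\<epsilon> > 0" "(\<integral>\<^sup>+x. G x \<partial>lebesgue_on ({a..b} \<inter> ball x0 \<epsilon>)) \<noteq> \<infinity>"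
    by (auto simp: critical_set_def G_def q_def)
  define U where "U = {a<..<b} \<inter> ball x0 \<epsilon>"
  have Uset: "U \<in> sets lebesgue" "{a..b} \<inter> ball x0 \<epsilon> \<in> sets lebesgue" by (auto simp: U_def)
  have Usub: "U \<subseteq> {a<..<b}" "U \<subseteq> {a..b} \<inter> ball x0 \<epsilon>" by (auto simp: U_def)
  have "(\<integral>\<^sup>+x. G x \<partial>lebesgue_on U) \<le> (\<integral>\<^sup>+x. G x \<partial>lebesgue_on ({a..b} \<inter> ball x0 \<epsilon>))"
    using Uset Usub by (simp add: nn_integral_restrict_space) (intro nn_integral_mono, auto simp: indicator_def)
  then have finU: "(\<integral>\<^sup>+x. G x \<partial>lebesgue_on U) < \<infinity>"
    using \<epsilon>(2) by (auto simp: less_top[symmetric] top_unique)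
  have wU: "w \<in> borel_measurable (lebesgue_on U)"
    by (rule measurable_restrict_mono[OF weight_measurable Usub(1)])
  have [measurable]: "(\<lambda>x. \<bar>x - x0\<bar> ^ j) \<in> borel_measurable (lebesgue_on U)"
    by (intro continuous_borel_measurable_lebesgue_on continuous_intros)
  note [measurable] = wU
  have "G \<in> borel_measurable (lebesgue_on U)"
    unfolding G_def ennreal_powr_def dist_power_of_nat by measurable
  then have "AE x in lebesgue_on U. G x \<noteq> \<infinity>"
    using finU by (intro nn_integral_PInf_AE) auto
  moreover have "AE x in lebesgue_on U. x \<noteq> x0"
    using AE_not_in[of "{x0}" lebesgue] Uset
    by (subst AE_lebesgue_on_iff) (auto simp: negligible_iff_null_sets[symmetric])
  moreover have "AE x in lebesgue_on U. 0 \<le> w x"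
    using w Usub by (intro AE_I2) (auto simp: weight_on_def)
  ultimately have wpos: "AE x in lebesgue_on U. 0 < w x"
  proof eventually_elim
    case (elim x)
    show ?case
    proof (rule ccontr)
      assume "\<not> 0 < w x"
      then have "w x = 0" using elim by simp
      then have "G x = \<infinity>" using elim
        by (simp add: G_def dist_power_of_nat ennreal_powr_def ennreal_divide_eq_top_iff)
      then show False using elim by simp
    qed
  qed
  \<comment> \<open>the integrand of the critical set condition, as a real-valued function\<close>
  define k where "k = (\<lambda>x. (\<bar>x - x0\<bar> ^ j / w x powr (1 / p)) powr q)"
  have kG: "AE x in lebesgue_on U. ennreal (k x) = G x"
    using wpos by eventually_elim (simp add: G_def k_def dist_power_of_nat ennreal_powr_def divide_ennreal)
  have "(\<integral>\<^sup>+x. ennreal (k x) \<partial>lebesgue_on U) < \<infinity>"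
    using finU nn_integral_cong_AE[OF kG] by simp
  then have intk: "integrable (lebesgue_on U) k"
    by (intro integrableI_nonneg) (auto simp: k_def)
  define K where "K = (\<integral>x. k x \<partial>lebesgue_on U)"
  have K: "0 \<le> K" unfolding K_def by (intro integral_nonneg_AE) (auto simp: k_def)
  have "(\<integral>x. \<bar>x - x0\<bar> ^ j * \<bar>f x\<bar> \<partial>lebesgue_on U) \<le> (K + 1) * Lp_norm (weight_measure a b w) p f"
    if f: "continuous_on UNIV f" for f
    unfolding Lp_norm_def
  \<comment> \<open>the estimate is applied to \<open>t f\<close> for all \<open>t\<close>, which is what makes the right-hand side homogeneous\<close>
  proof (rule scaling_bound[OF p _ _ K])
    fix t :: real assume t: "t > 0"
    have tf: "continuous_on UNIV (\<lambda>x. t * f x)" by (intro continuous_intros f)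
    note L = Lp_integral_eq[OF continuous_in_Lp[OF tf]]
    have L': "integrable (lebesgue_on U) (\<lambda>x. w x * \<bar>t * f x\<bar> powr p)"
      by (rule integrable_lebesgue_on_subset[OF L(2)]) (use Usub Uset in auto)
    have "t * (\<integral>x. \<bar>x - x0\<bar> ^ j * \<bar>f x\<bar> \<partial>lebesgue_on U) = (\<integral>x. t * (\<bar>x - x0\<bar> ^ j * \<bar>f x\<bar>) \<partial>lebesgue_on U)"
      by simp
    also have "\<dots> \<le> (\<integral>x. k x + w x * \<bar>t * f x\<bar> powr p \<partial>lebesgue_on U)"
    proof (rule integral_mono_AE)
      show "integrable (lebesgue_on U) (\<lambda>x. t * (\<bar>x - x0\<bar> ^ j * \<bar>f x\<bar>))"
        unfolding U_def ball_Int_Ioo by (intro continuous_integrable_Ioo continuous_intros f)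
      show "AE x in lebesgue_on U. t * (\<bar>x - x0\<bar> ^ j * \<bar>f x\<bar>) \<le> k x + w x * \<bar>t * f x\<bar> powr p"
        using wpos
      proof eventually_elim
        case (elim x)
        have "t * (\<bar>x - x0\<bar> ^ j * \<bar>f x\<bar>) = (\<bar>x - x0\<bar> ^ j / w x powr (1 / p)) * (w x powr (1 / p) * \<bar>t * f x\<bar>)"
          using elim t by (simp add: abs_mult)
        also have "\<dots> \<le> k x + (w x powr (1 / p) * \<bar>t * f x\<bar>) powr p"
          unfolding k_def q_def by (intro le_powr_add) (use assms in auto)
        also have "(w x powr (1 / p) * \<bar>t * f x\<bar>) powr p = w x * \<bar>t * f x\<bar> powr p"
          using elim assms by (subst powr_mult) (auto simp: powr_powr)
        finally show ?case .
      qed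
    qed (use intk L' in auto)
    also have "\<dots> = K + (\<integral>x. w x * \<bar>t * f x\<bar> powr p \<partial>lebesgue_on U)"
      using intk L' by (simp add: K_def)
    also have "(\<integral>x. w x * \<bar>t * f x\<bar> powr p \<partial>lebesgue_on U) \<le> (\<integral>x. w x * \<bar>t * f x\<bar> powr p \<partial>lebesgue_on {a<..<b})"
      using w Uset Usub by (intro integral_lebesgue_on_mono_set L) (auto simp: weight_on_def)
    also have "\<dots> = (\<integral>x. \<bar>t * f x\<bar> powr p \<partial>weight_measure a b w)" using L by simp
    also have "\<dots> = t powr p * (\<integral>x. \<bar>f x\<bar> powr p \<partial>weight_measure a b w)"
      using t by (simp add: abs_mult powr_mult)
    finally show "t * (\<integral>x. \<bar>x - x0\<bar> ^ j * \<bar>f x\<bar> \<partial>lebesgue_on U) \<le> K + t powr p * (\<integral>x. \<bar>f x\<bar> powr p \<partial>weight_measure a b w)"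
      by simp
  qed auto
  then show ?thesis
    using that[OF \<epsilon>(1), of "K + 1"] K wpos unfolding U_def by simp
qed

text \<open>
  For \<open>p = 1\<close> the critical set condition directly yields \<open>\<bar>x - x0\<bar>^j \<le> K w\<close> almost everywhere near \<open>x0\<close>.
\<close>

lemma noncritical_bound_1:
  assumes "p = 1" "x0 \<in> {a..b}" "x0 \<notin> critical_set a b w (real j) p"
  obtains \<epsilon> K where "\<epsilon> > 0" "0 \<le> K" "AE x in lebesgue_on ({a<..<b} \<inter> ball x0 \<epsilon>). 0 < w x"
    "\<And>f. continuous_on UNIV f \<Longrightarrow>
      (\<integral>x. \<bar>x - x0\<bar> ^ j * \<bar>f x\<bar> \<partial>lebesgue_on ({a<..<b} \<inter> ball x0 \<epsilon>)) \<le> K * Lp_norm (weight_measure a b w) p f"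
proof -
  define G where "G = (\<lambda>x. ennreal (dist_power (real j) x0 x) / ennreal (w x))"
  from assms obtain \<epsilon> where \<epsilon>: "\<epsilon> > 0" "esssup (lebesgue_on ({a..b} \<inter> ball x0 \<epsilon>)) G \<noteq> \<infinity>"
    by (auto simp: critical_set_def G_def)
  define U where "U = {a<..<b} \<inter> ball x0 \<epsilon>"
  define K where "K = enn2real (esssup (lebesgue_on ({a..b} \<inter> ball x0 \<epsilon>)) G)"
  have Uset: "U \<in> sets lebesgue" "{a..b} \<inter> ball x0 \<epsilon> \<in> sets lebesgue" by (auto simp: U_def)
  have Usub: "U \<subseteq> {a<..<b}" "U \<subseteq> {a..b} \<inter> ball x0 \<epsilon>" by (auto simp: U_def)
  have "AE x in lebesgue_on ({a..b} \<inter> ball x0 \<epsilon>). G x \<le> ennreal K"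
    using esssup_AE[of G] \<epsilon>(2) by (simp add: K_def less_top)
  then have GK: "AE x in lebesgue_on U. G x \<le> ennreal K"
    unfolding AE_lebesgue_on_iff[OF Uset(1)] AE_lebesgue_on_iff[OF Uset(2)]
    by (rule eventually_mono) (use Usub in blast)
  have K: "0 \<le> K" by (simp add: K_def)
  have "AE x in lebesgue_on U. x \<noteq> x0"
    using AE_not_in[of "{x0}" lebesgue] Uset
    by (subst AE_lebesgue_on_iff) (auto simp: negligible_iff_null_sets[symmetric])
  moreover have "AE x in lebesgue_on U. 0 \<le> w x"
    using w Usub by (intro AE_I2) (auto simp: weight_on_def)
  ultimately have wpos: "AE x in lebesgue_on U. 0 < w x"
    using GK
  proof eventually_elim
    case (elim x)
    show ?case
    proof (rule ccontr)
      assume "\<not> 0 < w x"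
      then have "w x = 0" using elim by simp
      then have "G x = \<infinity>" using elim
        by (simp add: G_def dist_power_of_nat ennreal_divide_eq_top_iff)
      then show False using elim by (simp add: top_unique)
    qed
  qed
  have "(\<integral>x. \<bar>x - x0\<bar> ^ j * \<bar>f x\<bar> \<partial>lebesgue_on U) \<le> K * Lp_norm (weight_measure a b w) p f"
    if f: "continuous_on UNIV f" for f
  proof -
    note L = Lp_integral_eq[OF continuous_in_Lp[OF f]]
    have L': "integrable (lebesgue_on U) (\<lambda>x. w x * \<bar>f x\<bar> powr p)"
      by (rule integrable_lebesgue_on_subset[OF L(2)]) (use Usub Uset in auto)
    have "(\<integral>x. \<bar>x - x0\<bar> ^ j * \<bar>f x\<bar> \<partial>lebesgue_on U) \<le> (\<integral>x. K * (w x * \<bar>f x\<bar> powr p) \<partial>lebesgue_on U)"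
    proof (rule integral_mono_AE)
      show "integrable (lebesgue_on U) (\<lambda>x. \<bar>x - x0\<bar> ^ j * \<bar>f x\<bar>)"
        unfolding U_def ball_Int_Ioo by (intro continuous_integrable_Ioo continuous_intros f)
      show "AE x in lebesgue_on U. \<bar>x - x0\<bar> ^ j * \<bar>f x\<bar> \<le> K * (w x * \<bar>f x\<bar> powr p)"
        using wpos GK
      proof eventually_elim
        case (elim x)
        then have "\<bar>x - x0\<bar> ^ j / w x \<le> K"
          using K by (simp add: G_def dist_power_of_nat divide_ennreal)
        then have "\<bar>x - x0\<bar> ^ j \<le> K * w x" using elim by (simp add: field_simps)
        then show ?case using assms(1) mult_right_mono[of "\<bar>x - x0\<bar> ^ j" "K * w x" "\<bar>f x\<bar>"] by (simp add: mult.assoc)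
      qed
    qed (use L' in auto)
    also have "\<dots> = K * (\<integral>x. w x * \<bar>f x\<bar> powr p \<partial>lebesgue_on U)" by simp
    also have "\<dots> \<le> K * (\<integral>x. w x * \<bar>f x\<bar> powr p \<partial>lebesgue_on {a<..<b})"
      using w Uset Usub K by (intro mult_left_mono integral_lebesgue_on_mono_set L) (auto simp: weight_on_def)
    also have "\<dots> = K * Lp_norm (weight_measure a b w) p f"
    proof -
      have "0 \<le> (\<integral>x. \<bar>f x\<bar> powr p \<partial>weight_measure a b w)"
        by (intro Bochner_Integration.integral_nonneg) auto
      then show ?thesis using L(1) assms(1) by (simp only: Lp_norm_def powr_one div_by_1)
    qed
    finally show ?thesis .
  qed
  then show ?thesis
    using that[OF \<epsilon>(1) K] wpos unfolding U_def by simp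
qed

end

lemma noncritical_bound:
  assumes "weight_on a b w" "1 \<le> p" "x0 \<in> {a..b}" "x0 \<notin> critical_set a b w (real j) p"
  obtains \<epsilon> K where "\<epsilon> > 0" "0 \<le> K" "AE x in lebesgue_on ({a<..<b} \<inter> ball x0 \<epsilon>). 0 < w x"
    "\<And>f. continuous_on UNIV f \<Longrightarrow>
      (\<integral>x. \<bar>x - x0\<bar> ^ j * \<bar>f x\<bar> \<partial>lebesgue_on ({a<..<b} \<inter> ball x0 \<epsilon>)) \<le> K * Lp_norm (weight_measure a b w) p f"
proof (cases "p = 1")
  case True
  show ?thesis by (rule noncritical_bound_1[OF assms(1,2) True assms(3,4)]) (rule that)
next
  case False
  then have "1 < p" using assms(2) by simp
  show ?thesis by (rule noncritical_bound_gt_1[OF assms(1,2) \<open>1 < p\<close> assms(3,4)]) (rule that)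
qed

section \<open>The a priori estimate for smooth functions\<close>

definition Lp_norm_sum :: "real measure \<Rightarrow> real \<Rightarrow> nat \<Rightarrow> (nat \<Rightarrow> real \<Rightarrow> real) \<Rightarrow> real" where
  "Lp_norm_sum M p m f = (\<Sum>i\<le>m. Lp_norm M p (f i))"

lemma Lp_norm_sum_nonneg: "0 \<le> Lp_norm_sum M p m f"
  by (simp add: Lp_norm_sum_def sum_nonneg Lp_norm_def)

lemma Lp_norm_le_sum: "k \<le> m \<Longrightarrow> Lp_norm M p (f k) \<le> Lp_norm_sum M p m f"
  unfolding Lp_norm_sum_def by (rule member_le_sum) (auto simp: Lp_norm_def)

text \<open>
  The a priori estimate. The left-hand side refers to Lebesgue measure and the right-hand side, in the
  application, to the weighted measure: this is a condition on how fast the weight may vanish in \<open>U\<close>.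
\<close>

definition controls_derivs :: "real measure \<Rightarrow> real \<Rightarrow> nat \<Rightarrow> nat \<Rightarrow> real set \<Rightarrow> bool" where
  "controls_derivs M p m n U \<longleftrightarrow> (\<exists>C\<ge>0. \<forall>\<phi>\<in>test_functions UNIV. \<forall>k\<le>n.
     (\<integral>x. \<bar>(deriv ^^ k) \<phi> x\<bar> \<partial>lebesgue_on U) \<le> C * Lp_norm_sum M p m (\<lambda>i. (deriv ^^ i) \<phi>))"

lemma C1_deriv:
  assumes "\<phi> \<in> test_functions UNIV"
  shows "C1 ((deriv ^^ k) \<phi>) ((deriv ^^ Suc k) \<phi>)"
  unfolding C1_def
  using smooth_deriv_has_deriv[OF test_functionsD(1)[OF assms]]
    smooth_deriv_continuous[OF test_functionsD(1)[OF assms]] by blast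

lemma uniform_constant:
  fixes F :: "nat \<Rightarrow> 'a \<Rightarrow> real"
  assumes "\<And>k. k \<le> n \<Longrightarrow> \<exists>C\<ge>0. \<forall>\<phi>\<in>T. F k \<phi> \<le> C * E \<phi>" "\<And>\<phi>. \<phi> \<in> T \<Longrightarrow> 0 \<le> E \<phi>"
  shows "\<exists>C\<ge>0. \<forall>\<phi>\<in>T. \<forall>k\<le>n. F k \<phi> \<le> C * E \<phi>"
proof -
  from assms(1) have "\<forall>k\<in>{..n}. \<exists>C. 0 \<le> C \<and> (\<forall>\<phi>\<in>T. F k \<phi> \<le> C * E \<phi>)" by auto
  then obtain C where C: "\<forall>k\<in>{..n}. 0 \<le> C k \<and> (\<forall>\<phi>\<in>T. F k \<phi> \<le> C k * E \<phi>)"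
    unfolding bchoice_iff by blast
  have "F k \<phi> \<le> (\<Sum>k\<le>n. C k) * E \<phi>" if "\<phi> \<in> T" "k \<le> n" for k \<phi>
  proof -
    have "F k \<phi> \<le> C k * E \<phi>" using C that by auto
    also have "\<dots> \<le> (\<Sum>k\<le>n. C k) * E \<phi>"
      using C that assms(2) by (intro mult_right_mono member_le_sum) auto
    finally show ?thesis .
  qed
  moreover have "0 \<le> (\<Sum>k\<le>n. C k)" using C by (intro sum_nonneg) auto
  ultimately show ?thesis by blast
qed

text \<open>
  By downward induction on \<open>k\<close>, the \<open>k\<close>-th derivative is integrable against \<open>\<bar>x - x0\<bar>\<close> to the power
  \<open>k - (\<kappa> + 1)\<close>, with a bound by the weighted norms. The top order is \<open>noncritical_bound\<close>; each further
  step is one application of the Hardy inequality, whose zeroth order term is again covered by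
  \<open>noncritical_bound\<close>. The subtraction is truncated at zero, which is what makes the orders below
  \<open>\<kappa> + 1\<close> come out without any power of the distance.
\<close>

lemma noncritical_controls_derivs:
  assumes w: "weight_on a b w" and p: "1 \<le> p" and x0: "x0 \<in> {a..b}" and "\<kappa> < m"
    and noncrit: "x0 \<notin> critical_set a b w (real (m - Suc \<kappa>)) p"
  obtains \<epsilon> where "\<epsilon> > 0" "AE x in lebesgue_on ({a<..<b} \<inter> ball x0 \<epsilon>). 0 < w x"
    "controls_derivs (weight_measure a b w) p m (Suc \<kappa>) ({a<..<b} \<inter> ball x0 \<epsilon>)"
proof -
  define j where "j = m - Suc \<kappa>"
  define \<mu> where "\<mu> = weight_measure a b w"
  obtain \<epsilon> K where \<epsilon>: "\<epsilon> > 0" "0 \<le> K" "AE x in lebesgue_on ({a<..<b} \<inter> ball x0 \<epsilon>). 0 < w x"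
    and K: "\<And>f. continuous_on UNIV f \<Longrightarrow>
      (\<integral>x. \<bar>x - x0\<bar> ^ j * \<bar>f x\<bar> \<partial>lebesgue_on ({a<..<b} \<inter> ball x0 \<epsilon>)) \<le> K * Lp_norm \<mu> p f"
    by (rule noncritical_bound[OF w p x0 noncrit], rule that, assumption+) (simp add: j_def \<mu>_def)
  define c d where "c = max a (x0 - \<epsilon>)" and "d = min b (x0 + \<epsilon>)"
  have U: "{a<..<b} \<inter> ball x0 \<epsilon> = {c<..<d}" by (simp add: ball_Int_Ioo c_def d_def)
  have cd: "c \<le> x0" "x0 \<le> d" using \<epsilon>(1) x0 by (auto simp: c_def d_def)
  let ?E = "\<lambda>\<phi>. Lp_norm_sum \<mu> p m (\<lambda>i. (deriv ^^ i) \<phi>)"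
  have top_weight: "integral {c..d} (\<lambda>x. \<bar>x - x0\<bar> ^ j * \<bar>(deriv ^^ k) \<phi> x\<bar>) \<le> K * ?E \<phi>"
    if "k \<le> m" "\<phi> \<in> test_functions UNIV" for k \<phi>
  proof -
    have cont: "continuous_on UNIV ((deriv ^^ k) \<phi>)"
      by (rule smooth_deriv_continuous[OF test_functionsD(1)[OF that(2)]])
    have "integral {c..d} (\<lambda>x. \<bar>x - x0\<bar> ^ j * \<bar>(deriv ^^ k) \<phi> x\<bar>) =
        (\<integral>x. \<bar>x - x0\<bar> ^ j * \<bar>(deriv ^^ k) \<phi> x\<bar> \<partial>lebesgue_on {c<..<d})"
      by (rule continuous_integrable_Ioo(2)[symmetric]) (intro continuous_intros cont)
    also have "\<dots> \<le> K * Lp_norm \<mu> p ((deriv ^^ k) \<phi>)"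
      using K[OF cont] unfolding U .
    also have "\<dots> \<le> K * ?E \<phi>"
      using Lp_norm_le_sum[OF that(1), of \<mu> p "\<lambda>i. (deriv ^^ i) \<phi>"] \<epsilon>(2) by (intro mult_left_mono)
    finally show ?thesis .
  qed
  have step: "\<exists>C\<ge>0. \<forall>\<phi>\<in>test_functions UNIV.
      integral {c..d} (\<lambda>x. \<bar>x - x0\<bar> ^ (k - Suc \<kappa>) * \<bar>(deriv ^^ k) \<phi> x\<bar>) \<le> C * ?E \<phi>" if "k \<le> m" for k
    using that
  proof (induction rule: inc_induct)
    case base
    show ?case by (intro exI[of _ K] conjI ballI \<epsilon>(2)) (use top_weight[of m] in \<open>simp add: j_def\<close>)
  next
    case (step k)
    then obtain C where C: "C \<ge> 0" "\<And>\<phi>. \<phi> \<in> test_functions UNIV \<Longrightarrow>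
      integral {c..d} (\<lambda>x. \<bar>x - x0\<bar> ^ (Suc k - Suc \<kappa>) * \<bar>(deriv ^^ Suc k) \<phi> x\<bar>) \<le> C * ?E \<phi>"
      by blast
    obtain B where B: "0 \<le> B" "\<And>g g'. C1 g g' \<Longrightarrow>
      integral {c..d} (\<lambda>x. \<bar>x - x0\<bar> ^ (k - Suc \<kappa>) * \<bar>g x\<bar>) \<le>
      B * (integral {c..d} (\<lambda>x. \<bar>x - x0\<bar> ^ j * \<bar>g x\<bar>) +
           integral {c..d} (\<lambda>x. \<bar>x - x0\<bar> ^ (Suc k - Suc \<kappa>) * \<bar>g' x\<bar>))"
      by (rule hardy[OF cd, of "Suc k - Suc \<kappa>" "k - Suc \<kappa>" j]) auto
    show ?case
    proof (intro exI[of _ "B * (K + C)"] conjI ballI)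
      fix \<phi> assume \<phi>: "\<phi> \<in> test_functions UNIV"
      have "integral {c..d} (\<lambda>x. \<bar>x - x0\<bar> ^ (k - Suc \<kappa>) * \<bar>(deriv ^^ k) \<phi> x\<bar>) \<le> B * (K * ?E \<phi> + C * ?E \<phi>)"
        using C1_deriv[OF \<phi>, of k] top_weight[OF _ \<phi>, of k] C(2)[OF \<phi>] B(1) step.hyps
        by (intro order_trans[OF B(2)] mult_left_mono add_mono) auto
      then show "integral {c..d} (\<lambda>x. \<bar>x - x0\<bar> ^ (k - Suc \<kappa>) * \<bar>(deriv ^^ k) \<phi> x\<bar>) \<le> B * (K + C) * ?E \<phi>"
        by (simp add: algebra_simps)
    qed (use B(1) C(1) \<epsilon>(2) in auto)
  qed
  have "\<exists>C\<ge>0. \<forall>\<phi>\<in>test_functions UNIV. \<forall>k\<le>Suc \<kappa>. (\<integral>x. \<bar>(deriv ^^ k) \<phi> x\<bar> \<partial>lebesgue_on {c<..<d}) \<le> C * ?E \<phi>"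
  proof (rule uniform_constant)
    fix k assume k: "k \<le> Suc \<kappa>"
    then have "k - Suc \<kappa> = 0" "k \<le> m" using \<open>\<kappa> < m\<close> by auto
    moreover have "(\<integral>x. \<bar>(deriv ^^ k) \<phi> x\<bar> \<partial>lebesgue_on {c<..<d}) = integral {c..d} (\<lambda>x. \<bar>(deriv ^^ k) \<phi> x\<bar>)"
      if "\<phi> \<in> test_functions UNIV" for \<phi>
      by (rule continuous_integrable_Ioo(2))
        (intro continuous_intros smooth_deriv_continuous test_functionsD(1)[OF that])
    ultimately show "\<exists>C\<ge>0. \<forall>\<phi>\<in>test_functions UNIV. (\<integral>x. \<bar>(deriv ^^ k) \<phi> x\<bar> \<partial>lebesgue_on {c<..<d}) \<le> C * ?E \<phi>"
      using step[of k] by simp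
  qed (rule Lp_norm_sum_nonneg)
  then show ?thesis
    using that[OF \<epsilon>(1,3)] unfolding controls_derivs_def U \<mu>_def by blast
qed

text \<open>
  The neighbourhoods of the previous lemma cover the compact interval \<open>[a, b]\<close>; the integral over
  \<open>(a, b)\<close> is at most the sum over a finite subcover.
\<close>

lemma no_critical_controls_derivs:
  assumes w: "weight_on a b w" and p: "1 \<le> p" and "\<kappa> < m"
    and noncrit: "critical_set a b w (real (m - Suc \<kappa>)) p = {}"
  shows "AE x in lebesgue_on {a<..<b}. 0 < w x"
    "controls_derivs (weight_measure a b w) p m (Suc \<kappa>) {a<..<b}"
proof -
  define \<mu> where "\<mu> = weight_measure a b w"
  let ?U = "\<lambda>y \<epsilon>. {a<..<b} \<inter> ball y \<epsilon>"
  have "\<forall>y\<in>{a..b}. \<exists>\<epsilon>. \<epsilon> > 0 \<and> (AE x in lebesgue_on (?U y \<epsilon>). 0 < w x) \<and> controls_derivs \<mu> p m (Suc \<kappa>) (?U y \<epsilon>)"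
  proof
    fix y assume "y \<in> {a..b}"
    then obtain \<epsilon> where "\<epsilon> > 0" "AE x in lebesgue_on (?U y \<epsilon>). 0 < w x"
        "controls_derivs \<mu> p m (Suc \<kappa>) (?U y \<epsilon>)"
      unfolding \<mu>_def by (rule noncritical_controls_derivs[OF w p _ \<open>\<kappa> < m\<close>]) (simp_all add: noncrit)
    then show "\<exists>\<epsilon>. \<epsilon> > 0 \<and> (AE x in lebesgue_on (?U y \<epsilon>). 0 < w x) \<and> controls_derivs \<mu> p m (Suc \<kappa>) (?U y \<epsilon>)"
      by blast
  qed
  then obtain \<epsilon> where \<epsilon>: "\<And>y. y \<in> {a..b} \<Longrightarrow> \<epsilon> y > 0"
    "\<And>y. y \<in> {a..b} \<Longrightarrow> AE x in lebesgue_on (?U y (\<epsilon> y)). 0 < w x"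
    "\<And>y. y \<in> {a..b} \<Longrightarrow> controls_derivs \<mu> p m (Suc \<kappa>) (?U y (\<epsilon> y))"
    unfolding bchoice_iff by blast
  obtain Y where Y: "Y \<subseteq> {a..b}" "finite Y" "{a..b} \<subseteq> (\<Union>y\<in>Y. ball y (\<epsilon> y))"
  proof (rule compactE_image[of "{a..b}" "{a..b}" "\<lambda>y. ball y (\<epsilon> y)"])
    show "{a..b} \<subseteq> (\<Union>y\<in>{a..b}. ball y (\<epsilon> y))" using \<epsilon>(1) by force
  qed auto
  have Uset: "?U y e \<in> sets lebesgue" for y e by simp
  have "AE x in lebesgue. \<forall>y\<in>Y. x \<in> ?U y (\<epsilon> y) \<longrightarrow> 0 < w x"
    using \<epsilon>(2) Y(1) unfolding AE_lebesgue_on_iff[OF Uset] by (intro AE_finite_allI Y(2)) blast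
  then have "AE x in lebesgue. x \<in> {a<..<b} \<longrightarrow> 0 < w x"
  proof eventually_elim
    case (elim x)
    show ?case
    proof
      assume x: "x \<in> {a<..<b}"
      then have "x \<in> {a..b}" by simp
      then obtain y where "y \<in> Y" "x \<in> ball y (\<epsilon> y)" using Y(3) by blast
      then show "0 < w x" using elim x by blast
    qed
  qed
  then show "AE x in lebesgue_on {a<..<b}. 0 < w x" by (subst AE_lebesgue_on_iff) auto
  let ?E = "\<lambda>\<phi>. Lp_norm_sum \<mu> p m (\<lambda>i. (deriv ^^ i) \<phi>)"
  have "\<forall>y\<in>Y. \<exists>C. C \<ge> 0 \<and> (\<forall>\<phi>\<in>test_functions UNIV. \<forall>k\<le>Suc \<kappa>.
     (\<integral>x. \<bar>(deriv ^^ k) \<phi> x\<bar> \<partial>lebesgue_on (?U y (\<epsilon> y))) \<le> C * ?E \<phi>)"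
    using \<epsilon>(3) Y(1) unfolding controls_derivs_def by blast
  then obtain C where C: "\<And>y. y \<in> Y \<Longrightarrow> C y \<ge> 0" "\<And>y \<phi> k. y \<in> Y \<Longrightarrow> \<phi> \<in> test_functions UNIV \<Longrightarrow> k \<le> Suc \<kappa> \<Longrightarrow>
      (\<integral>x. \<bar>(deriv ^^ k) \<phi> x\<bar> \<partial>lebesgue_on (?U y (\<epsilon> y))) \<le> C y * ?E \<phi>"
    unfolding bchoice_iff by blast
  have "(\<integral>x. \<bar>(deriv ^^ k) \<phi> x\<bar> \<partial>lebesgue_on {a<..<b}) \<le> (\<Sum>y\<in>Y. C y) * ?E \<phi>"
    if \<phi>: "\<phi> \<in> test_functions UNIV" and k: "k \<le> Suc \<kappa>" for \<phi> k
  proof -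
    define f where "f = (\<lambda>x. \<bar>(deriv ^^ k) \<phi> x\<bar>)"
    have cont: "continuous_on UNIV f"
      unfolding f_def by (intro continuous_intros smooth_deriv_continuous test_functionsD(1)[OF \<phi>])
    have int: "integrable (lebesgue_on {a<..<b}) f" "integrable (lebesgue_on (?U y e)) f" for y e
      unfolding ball_Int_Ioo by (rule continuous_integrable_Ioo(1)[OF cont])+
    have "(\<integral>x. f x \<partial>lebesgue_on {a<..<b}) = (\<integral>x. indicator {a<..<b} x * f x \<partial>lebesgue)"
      by (simp add: integral_restrict_space)
    also have "\<dots> \<le> (\<integral>x. (\<Sum>y\<in>Y. indicator (?U y (\<epsilon> y)) x * f x) \<partial>lebesgue)"
    proof (rule integral_mono)
      show "integrable lebesgue (\<lambda>x. indicator {a<..<b} x * f x)"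
        using int(1) by (simp add: integrable_restrict_space)
      show "integrable lebesgue (\<lambda>x. \<Sum>y\<in>Y. indicator (?U y (\<epsilon> y)) x * f x)"
        using int(2) by (intro Bochner_Integration.integrable_sum) (simp add: integrable_restrict_space)
      fix x
      show "indicator {a<..<b} x * f x \<le> (\<Sum>y\<in>Y. indicator (?U y (\<epsilon> y)) x * f x)"
      proof (cases "x \<in> {a<..<b}")
        case True
        then have "x \<in> {a..b}" by simp
        then obtain y where "y \<in> Y" "x \<in> ball y (\<epsilon> y)" using Y(3) by blast
        then have "indicator {a<..<b} x * f x = indicator (?U y (\<epsilon> y)) x * f x"
          using True by (simp add: indicator_def)
        also have "\<dots> \<le> (\<Sum>y\<in>Y. indicator (?U y (\<epsilon> y)) x * f x)"
          using \<open>y \<in> Y\<close> Y(2) by (intro member_le_sum) (auto simp: f_def)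
        finally show ?thesis .
      qed (auto intro!: sum_nonneg simp: f_def)
    qed
    also have "\<dots> = (\<Sum>y\<in>Y. \<integral>x. indicator (?U y (\<epsilon> y)) x * f x \<partial>lebesgue)"
      using int(2) by (intro Bochner_Integration.integral_sum) (simp add: integrable_restrict_space)
    also have "\<dots> = (\<Sum>y\<in>Y. \<integral>x. f x \<partial>lebesgue_on (?U y (\<epsilon> y)))"
      by (simp add: integral_restrict_space)
    also have "\<dots> \<le> (\<Sum>y\<in>Y. C y * ?E \<phi>)"
      using C(2)[OF _ \<phi> k] by (intro sum_mono) (simp add: f_def)
    finally show ?thesis by (simp add: f_def sum_distrib_right)
  qed
  moreover have "0 \<le> (\<Sum>y\<in>Y. C y)" using C(1) by (intro sum_nonneg)
  ultimately show "controls_derivs (weight_measure a b w) p m (Suc \<kappa>) {a<..<b}"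
    unfolding controls_derivs_def \<mu>_def by blast
qed

section \<open>Convergence in the weighted Lebesgue space\<close>

lemma borel_measurable_lebesgue_on_AE:
  fixes f g :: "real \<Rightarrow> real"
  assumes f: "f \<in> borel_measurable (lebesgue_on S)" and S: "S \<in> sets lebesgue"
    and eq: "AE x in lebesgue_on S. f x = g x"
  shows "g \<in> borel_measurable (lebesgue_on S)"
proof -
  have "(\<lambda>x. if x \<in> S then f x else 0) \<in> borel_measurable lebesgue"
    using f S borel_measurable_if_I by blast
  moreover have "AE x in lebesgue. (if x \<in> S then f x else 0) = (if x \<in> S then g x else 0)"
    using eq unfolding AE_lebesgue_on_iff[OF S] by (auto elim!: eventually_mono)
  ultimately have "(\<lambda>x. if x \<in> S then g x else 0) \<in> borel_measurable lebesgue"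
    by (rule borel_measurable_AE)
  then show ?thesis using S borel_measurable_if by blast
qed

lemma powr_add_le:
  fixes x y :: real
  assumes "0 < p"
  shows "\<bar>x + y\<bar> powr p \<le> 2 powr p * (\<bar>x\<bar> powr p + \<bar>y\<bar> powr p)"
proof -
  have "\<bar>x + y\<bar> powr p \<le> (2 * max \<bar>x\<bar> \<bar>y\<bar>) powr p" using assms by (intro powr_mono2) auto
  also have "\<dots> = 2 powr p * max \<bar>x\<bar> \<bar>y\<bar> powr p" by (simp add: powr_mult)
  also have "\<dots> \<le> 2 powr p * (\<bar>x\<bar> powr p + \<bar>y\<bar> powr p)"
    by (intro mult_left_mono) (auto simp: max_def)
  finally show ?thesis .
qed

text \<open>
  A quasi-norm inequality is enough for all convergence arguments below. The factor \<open>4\<close> consists of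
  a factor \<open>2\<close> from the \<open>p\<close>-th power of a sum and of \<open>2 powr (1 / p) \<le> 2\<close> from the \<open>p\<close>-th root.
\<close>

lemma Lp_space_add:
  assumes "1 \<le> p" "f \<in> Lp_space M p" "g \<in> Lp_space M p"
  shows "(\<lambda>x. f x + g x) \<in> Lp_space M p"
    and "Lp_norm M p (\<lambda>x. f x + g x) \<le> 4 * (Lp_norm M p f + Lp_norm M p g)"
proof -
  note [measurable] = assms(2,3)[unfolded Lp_space_def, simplified, THEN conjunct1]
  have int: "integrable M (\<lambda>x. 2 powr p * (\<bar>f x\<bar> powr p + \<bar>g x\<bar> powr p))"
    using assms by (auto simp: Lp_space_def)
  have le: "AE x in M. norm (\<bar>f x + g x\<bar> powr p) \<le> norm (2 powr p * (\<bar>f x\<bar> powr p + \<bar>g x\<bar> powr p))"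
    using powr_add_le[of p] assms by (intro AE_I2) (auto simp: abs_of_nonneg)
  have intfg: "integrable M (\<lambda>x. \<bar>f x + g x\<bar> powr p)"
    by (rule Bochner_Integration.integrable_bound[OF int _ le]) measurable
  then show "(\<lambda>x. f x + g x) \<in> Lp_space M p" by (simp add: Lp_space_def)
  define X Y where "X = (\<integral>x. \<bar>f x\<bar> powr p \<partial>M)" and "Y = (\<integral>x. \<bar>g x\<bar> powr p \<partial>M)"
  have XY: "0 \<le> X" "0 \<le> Y" unfolding X_def Y_def by (intro Bochner_Integration.integral_nonneg; simp)+
  have "(\<integral>x. \<bar>f x + g x\<bar> powr p \<partial>M) \<le> (\<integral>x. 2 powr p * (\<bar>f x\<bar> powr p + \<bar>g x\<bar> powr p) \<partial>M)"
    using powr_add_le[of p] assms by (intro integral_mono intfg int) auto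
  also have "\<dots> = 2 powr p * (X + Y)"
    using assms by (simp add: X_def Y_def Lp_space_def)
  finally have "(\<integral>x. \<bar>f x + g x\<bar> powr p \<partial>M) powr (1 / p) \<le> (2 powr p * (X + Y)) powr (1 / p)"
    using assms by (intro powr_mono2 Bochner_Integration.integral_nonneg) auto
  also have "\<dots> = 2 * (X + Y) powr (1 / p)"
    using assms XY by (simp add: powr_mult powr_powr)
  also have "(X + Y) powr (1 / p) \<le> 2 * (X powr (1 / p) + Y powr (1 / p))"
  proof -
    have "(X + Y) powr (1 / p) \<le> 2 powr (1 / p) * (X powr (1 / p) + Y powr (1 / p))"
      using powr_add_le[of "1 / p" X Y] XY assms by simp
    also have "\<dots> \<le> 2 powr 1 * (X powr (1 / p) + Y powr (1 / p))"
      using assms by (intro mult_right_mono powr_mono) auto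
    finally show ?thesis by simp
  qed
  finally show "Lp_norm M p (\<lambda>x. f x + g x) \<le> 4 * (Lp_norm M p f + Lp_norm M p g)"
    by (simp add: Lp_norm_def X_def Y_def)
qed

lemma Lp_space_uminus: "f \<in> Lp_space M p \<Longrightarrow> (\<lambda>x. - f x) \<in> Lp_space M p"
  by (simp add: Lp_space_def)

lemma Lp_norm_minus_commute: "Lp_norm M p (\<lambda>x. f x - g x) = Lp_norm M p (\<lambda>x. g x - f x)"
  by (simp add: Lp_norm_def abs_minus_commute)

lemma Lp_space_diff:
  assumes "1 \<le> p" "f \<in> Lp_space M p" "g \<in> Lp_space M p"
  shows "(\<lambda>x. f x - g x) \<in> Lp_space M p"
  using Lp_space_add(1)[OF assms(1,2) Lp_space_uminus[OF assms(3)]] by simp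

lemma Lp_norm_triangle:
  assumes "1 \<le> p" "f \<in> Lp_space M p" "g \<in> Lp_space M p" "h \<in> Lp_space M p"
  shows "Lp_norm M p (\<lambda>x. f x - h x) \<le> 4 * (Lp_norm M p (\<lambda>x. f x - g x) + Lp_norm M p (\<lambda>x. g x - h x))"
  using Lp_space_add(2)[OF assms(1) Lp_space_diff[OF assms(1,2,3)] Lp_space_diff[OF assms(1,3,4)]] by simp

lemma Lp_convergence_AE_subseq:
  assumes "1 \<le> p" "\<And>n. f n \<in> Lp_space M p" "g \<in> Lp_space M p"
    and lim: "(\<lambda>n. Lp_norm M p (\<lambda>x. f n x - g x)) \<longlonglongrightarrow> 0"
  obtains r :: "nat \<Rightarrow> nat" where "strict_mono r" "AE x in M. (\<lambda>n. f (r n) x) \<longlonglongrightarrow> g x"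
proof -
  define e where "e = (\<lambda>n x. \<bar>f n x - g x\<bar> powr p)"
  have int: "integrable M (e n)" for n
    using Lp_space_diff[OF assms(1,2,3), of n] by (simp add: Lp_space_def e_def)
  have eq: "(\<integral>x. norm (e n x) \<partial>M) = Lp_norm M p (\<lambda>x. f n x - g x) powr p" for n
  proof -
    have "0 \<le> (\<integral>x. \<bar>f n x - g x\<bar> powr p \<partial>M)" by (intro Bochner_Integration.integral_nonneg) simp
    then show ?thesis using assms(1) by (simp add: Lp_norm_def e_def powr_powr)
  qed
  have "(\<lambda>n. Lp_norm M p (\<lambda>x. f n x - g x) powr p) \<longlonglongrightarrow> 0 powr p"
    using lim assms(1) by (intro tendsto_powr' tendsto_const) (auto simp: Lp_norm_def)
  then have "(\<lambda>n. \<integral>x. norm (e n x) \<partial>M) \<longlonglongrightarrow> 0" unfolding eq by simp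
  then obtain r where r: "strict_mono r" "AE x in M. (\<lambda>n. e (r n) x) \<longlonglongrightarrow> 0"
    using tendsto_L1_AE_subseq[of M e, OF int] by blast
  from r(2) have "AE x in M. (\<lambda>n. f (r n) x) \<longlonglongrightarrow> g x"
  proof eventually_elim
    case (elim x)
    have "(\<lambda>n. e (r n) x powr (1 / p)) \<longlonglongrightarrow> 0 powr (1 / p)"
      using elim assms(1) by (intro tendsto_powr' tendsto_const) (auto simp: e_def)
    then have "(\<lambda>n. \<bar>f (r n) x - g x\<bar>) \<longlonglongrightarrow> 0"
      using assms(1) by (simp add: e_def powr_powr)
    then show ?case by (simp add: LIM_zero_cancel tendsto_rabs_zero_iff)
  qed
  with r(1) show ?thesis by (rule that)
qed

section \<open>Passage to the limit\<close>

text \<open>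
  An interval on which the weight is positive and the derivatives of order at most \<open>n\<close> of smooth
  functions obey the a priori estimate with the constant \<open>C\<close>.
\<close>

locale controlled_interval =
  fixes a b p :: real and w :: "real \<Rightarrow> real" and m n :: nat and c d C :: real
  assumes w: "weight_on a b w" and p: "1 \<le> p" and ac: "a \<le> c" and cd: "c < d" and db: "d \<le> b"
    and wpos: "AE x in lebesgue_on {c<..<d}. 0 < w x" and nm: "n \<le> m"
    and C: "0 \<le> C" "\<And>\<phi> k. \<phi> \<in> test_functions UNIV \<Longrightarrow> k \<le> n \<Longrightarrow>
      (\<integral>x. \<bar>(deriv ^^ k) \<phi> x\<bar> \<partial>lebesgue_on {c<..<d})
        \<le> C * Lp_norm_sum (weight_measure a b w) p m (\<lambda>i. (deriv ^^ i) \<phi>)"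
begin

abbreviation "\<mu> \<equiv> weight_measure a b w"
abbreviation "U \<equiv> {c<..<d}"

lemma U_sub: "U \<subseteq> {a<..<b}" using ac db by auto

lemma measurable_on_U:
  "f \<in> Lp_space \<mu> p \<Longrightarrow> f \<in> borel_measurable (lebesgue_on U)"
  using measurable_restrict_mono[OF _ U_sub] measurable_weight_measure[OF w p]
  by (auto simp: Lp_space_def)

lemma AE_weight_measure_imp_AE_U:
  assumes "AE x in \<mu>. P x"
  shows "AE x in lebesgue_on U. P x"
proof -
  have "AE x in lebesgue_on {a<..<b}. 0 < w x \<longrightarrow> P x"
  proof -
    have "(\<lambda>x. ennreal (w x)) \<in> borel_measurable (lebesgue_on {a<..<b})"
      using weight_measurable[OF w p] by measurable
    then show ?thesis
      using assms unfolding weight_measure_def by (subst (asm) AE_density) (simp_all)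
  qed
  then have "AE x in lebesgue. x \<in> {a<..<b} \<longrightarrow> 0 < w x \<longrightarrow> P x"
    by (subst (asm) AE_lebesgue_on_iff) auto
  moreover have "AE x in lebesgue. x \<in> U \<longrightarrow> 0 < w x"
    using wpos by (subst (asm) AE_lebesgue_on_iff) auto
  ultimately have "AE x in lebesgue. x \<in> U \<longrightarrow> P x"
    by eventually_elim (use U_sub in auto)
  then show ?thesis by (subst AE_lebesgue_on_iff) auto
qed

lemma test_deriv_Lp:
  assumes "\<phi> \<in> test_functions UNIV"
  shows "(deriv ^^ k) \<phi> \<in> Lp_space \<mu> p"
  by (intro continuous_in_Lp[OF w p] smooth_deriv_continuous test_functionsD(1)[OF assms])

lemma test_deriv_integrable:
  assumes "\<phi> \<in> test_functions UNIV"
  shows "integrable (lebesgue_on U) ((deriv ^^ k) \<phi>)"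
  by (intro continuous_integrable_Ioo smooth_deriv_continuous test_functionsD(1)[OF assms])

text \<open>
  The a priori estimate for \<open>\<phi> h - \<psi>\<close> is passed to the limit. Along a subsequence the \<open>k\<close>-th
  derivatives converge \<open>\<mu>\<close>-almost everywhere, hence Lebesgue-almost everywhere, and the Fatou lemma
  applies. The two choices of interest are \<open>\<psi> = 0\<close>, which bounds the tangential derivative, and
  \<open>\<psi> = \<phi> h\<close>, which gives convergence in \<open>L\<^sup>1\<close>.
\<close>

lemma limit_deriv_bound:
  assumes v: "\<And>i. i \<le> m \<Longrightarrow> v i \<in> Lp_space \<mu> p"
    and \<phi>: "\<And>h. \<phi> h \<in> test_functions UNIV"
    and lim: "\<And>i. i \<le> m \<Longrightarrow> (\<lambda>h. Lp_norm \<mu> p (\<lambda>x. (deriv ^^ i) (\<phi> h) x - v i x)) \<longlonglongrightarrow> 0"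
    and \<psi>: "\<psi> \<in> test_functions UNIV" and k: "k \<le> n"
  shows "integrable (lebesgue_on U) (\<lambda>x. v k x - (deriv ^^ k) \<psi> x)"
    and "(\<integral>x. \<bar>v k x - (deriv ^^ k) \<psi> x\<bar> \<partial>lebesgue_on U) \<le>
          4 * C * Lp_norm_sum \<mu> p m (\<lambda>i x. v i x - (deriv ^^ i) \<psi> x)"
proof -
  define S where "S = Lp_norm_sum \<mu> p m (\<lambda>i x. v i x - (deriv ^^ i) \<psi> x)"
  define e where "e = (\<lambda>h. Lp_norm_sum \<mu> p m (\<lambda>i x. (deriv ^^ i) (\<phi> h) x - v i x))"
  have km: "k \<le> m" using k nm by simp
  obtain r where r: "strict_mono r" "AE x in \<mu>. (\<lambda>l. (deriv ^^ k) (\<phi> (r l)) x) \<longlonglongrightarrow> v k x"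
    using Lp_convergence_AE_subseq[OF p test_deriv_Lp[OF \<phi>] v[OF km] lim[OF km]] by blast
  \<comment> \<open>the error of the approximation, summed over all orders\<close>
  have e0: "e \<longlonglongrightarrow> 0"
    unfolding e_def Lp_norm_sum_def using tendsto_sum[of "{..m}", OF lim] by simp
  then have e0r: "(\<lambda>l. e (r l)) \<longlonglongrightarrow> 0"
    using LIMSEQ_subseq_LIMSEQ[OF e0 r(1)] by (simp add: o_def)
  have le: "(\<integral>\<^sup>+x. ennreal \<bar>(deriv ^^ k) (\<phi> h) x - (deriv ^^ k) \<psi> x\<bar> \<partial>lebesgue_on U) \<le> ennreal (4 * C * (e h + S))" for h
  proof -
    have sm: "smooth (\<phi> h)" "smooth \<psi>" using \<phi> \<psi> test_functionsD(1) by blast+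
    note D = deriv_funpow_diff[OF sm]
    have "(\<integral>x. \<bar>(deriv ^^ k) (\<phi> h) x - (deriv ^^ k) \<psi> x\<bar> \<partial>lebesgue_on U)
      \<le> C * Lp_norm_sum \<mu> p m (\<lambda>i x. (deriv ^^ i) (\<phi> h) x - (deriv ^^ i) \<psi> x)"
      using C(2)[OF test_functions_diff[OF \<phi> \<psi>] k, of h] unfolding D .
    also have "\<dots> \<le> C * (4 * (e h + S))"
    proof (intro mult_left_mono C(1))
      have "Lp_norm_sum \<mu> p m (\<lambda>i x. (deriv ^^ i) (\<phi> h) x - (deriv ^^ i) \<psi> x) \<le>
        (\<Sum>i\<le>m. 4 * (Lp_norm \<mu> p (\<lambda>x. (deriv ^^ i) (\<phi> h) x - v i x) + Lp_norm \<mu> p (\<lambda>x. v i x - (deriv ^^ i) \<psi> x)))"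
        unfolding Lp_norm_sum_def
        by (intro sum_mono Lp_norm_triangle p test_deriv_Lp \<phi> \<psi> v) auto
      then show "Lp_norm_sum \<mu> p m (\<lambda>i x. (deriv ^^ i) (\<phi> h) x - (deriv ^^ i) \<psi> x) \<le> 4 * (e h + S)"
        by (simp add: e_def S_def Lp_norm_sum_def sum.distrib flip: sum_distrib_left)
    qed
    finally have "(\<integral>x. \<bar>(deriv ^^ k) (\<phi> h) x - (deriv ^^ k) \<psi> x\<bar> \<partial>lebesgue_on U) \<le> 4 * C * (e h + S)"
      by (simp add: algebra_simps)
    moreover have "integrable (lebesgue_on U) (\<lambda>x. \<bar>(deriv ^^ k) (\<phi> h) x - (deriv ^^ k) \<psi> x\<bar>)"
      by (intro integrable_abs Bochner_Integration.integrable_diff test_deriv_integrable \<phi> \<psi>)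
    ultimately show ?thesis
      by (subst nn_integral_eq_integral) (auto intro: ennreal_leI)
  qed
  have meas: "(\<lambda>x. v k x - (deriv ^^ k) \<psi> x) \<in> borel_measurable (lebesgue_on U)"
    using measurable_on_U[OF v[OF km]] measurable_on_U[OF test_deriv_Lp[OF \<psi>]] by measurable
  have "(\<integral>\<^sup>+x. ennreal \<bar>v k x - (deriv ^^ k) \<psi> x\<bar> \<partial>lebesgue_on U) =
     (\<integral>\<^sup>+x. liminf (\<lambda>l. ennreal \<bar>(deriv ^^ k) (\<phi> (r l)) x - (deriv ^^ k) \<psi> x\<bar>) \<partial>lebesgue_on U)"
  proof (rule nn_integral_cong_AE)
    show "AE x in lebesgue_on U. ennreal \<bar>v k x - (deriv ^^ k) \<psi> x\<bar> =
        liminf (\<lambda>l. ennreal \<bar>(deriv ^^ k) (\<phi> (r l)) x - (deriv ^^ k) \<psi> x\<bar>)"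
      using AE_weight_measure_imp_AE_U[OF r(2)]
    proof eventually_elim
      case (elim x)
      have "(\<lambda>l. ennreal \<bar>(deriv ^^ k) (\<phi> (r l)) x - (deriv ^^ k) \<psi> x\<bar>) \<longlonglongrightarrow> ennreal \<bar>v k x - (deriv ^^ k) \<psi> x\<bar>"
        by (intro tendsto_ennrealI tendsto_rabs tendsto_diff elim tendsto_const)
      then show ?case by (rule lim_imp_Liminf[symmetric, rotated]) simp
    qed
  qed
  also have "\<dots> \<le> liminf (\<lambda>l. \<integral>\<^sup>+x. ennreal \<bar>(deriv ^^ k) (\<phi> (r l)) x - (deriv ^^ k) \<psi> x\<bar> \<partial>lebesgue_on U)"
  proof (rule nn_integral_liminf)
    show "(\<lambda>x. ennreal \<bar>(deriv ^^ k) (\<phi> (r l)) x - (deriv ^^ k) \<psi> x\<bar>) \<in> borel_measurable (lebesgue_on U)" for l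
      using measurable_on_U[OF test_deriv_Lp[OF \<phi>]] measurable_on_U[OF test_deriv_Lp[OF \<psi>]] by measurable
  qed
  also have "\<dots> \<le> liminf (\<lambda>l. ennreal (4 * C * (e (r l) + S)))"
    by (intro Liminf_mono always_eventually allI le)
  also have "\<dots> = ennreal (4 * C * S)"
  proof (rule lim_imp_Liminf)
    have "(\<lambda>l. ennreal (4 * C * (e (r l) + S))) \<longlonglongrightarrow> ennreal (4 * C * (0 + S))"
      by (intro tendsto_ennrealI tendsto_intros e0r)
    then show "(\<lambda>l. ennreal (4 * C * (e (r l) + S))) \<longlonglongrightarrow> ennreal (4 * C * S)" by simp
  qed simp
  finally have bd: "(\<integral>\<^sup>+x. ennreal \<bar>v k x - (deriv ^^ k) \<psi> x\<bar> \<partial>lebesgue_on U) \<le> ennreal (4 * C * S)" .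
  then show int: "integrable (lebesgue_on U) (\<lambda>x. v k x - (deriv ^^ k) \<psi> x)"
    using meas by (intro integrableI_bounded) (auto simp: le_less_trans)
  have "0 \<le> S" by (simp add: S_def Lp_norm_sum_nonneg)
  then show "(\<integral>x. \<bar>v k x - (deriv ^^ k) \<psi> x\<bar> \<partial>lebesgue_on U) \<le>
          4 * C * Lp_norm_sum \<mu> p m (\<lambda>i x. v i x - (deriv ^^ i) \<psi> x)"
    using bd int C(1) unfolding S_def[symmetric]
    by (subst (asm) nn_integral_eq_integral) (auto simp: ennreal_le_iff)
qed

end

lemma deriv_zero_at_endpoints:
  assumes "\<psi> \<in> test_functions {c<..<d::real}" "x \<notin> {c<..<d}"
  shows "(deriv ^^ k) \<psi> x = 0"
  using assms test_functionsD(3)[OF assms(1)] by (intro deriv_zero_outside_support) blast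

lemma integration_by_parts_test_function:
  assumes "smooth \<phi>" "\<psi> \<in> test_functions {c<..<d}" "c < d"
  shows "(\<integral>x. \<phi> x * (deriv ^^ k) \<psi> x \<partial>lebesgue_on {c<..<d}) =
    (- 1) ^ k * (\<integral>x. (deriv ^^ k) \<phi> x * \<psi> x \<partial>lebesgue_on {c<..<d})"
  using assms(1)
proof (induction k arbitrary: \<phi>)
  case (Suc k)
  define \<eta> where "\<eta> = (deriv ^^ k) \<psi>"
  note sm\<psi> = test_functionsD(1)[OF assms(2)]
  have \<phi>': "(\<phi> has_real_derivative deriv \<phi> x) (at x)" for x
    using smooth_deriv_has_deriv[OF Suc.prems, of 0] by simp
  have \<eta>': "(\<eta> has_real_derivative deriv \<eta> x) (at x)" for x
    using smooth_deriv_has_deriv[OF sm\<psi>, of k] by (simp add: \<eta>_def)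
  have cont: "continuous_on UNIV \<phi>" "continuous_on UNIV (deriv \<phi>)" "continuous_on UNIV \<eta>" "continuous_on UNIV (deriv \<eta>)"
    using smooth_deriv_continuous[OF Suc.prems, of _ 0] smooth_deriv_continuous[OF Suc.prems, of _ 1]
      smooth_deriv_continuous[OF sm\<psi>, of _ k] smooth_deriv_continuous[OF sm\<psi>, of _ "Suc k"]
    by (simp_all add: \<eta>_def)
  have "((\<lambda>x. \<phi> x * deriv \<eta> x + deriv \<phi> x * \<eta> x) has_integral (\<phi> d * \<eta> d - \<phi> c * \<eta> c)) {c..d}"
  proof (rule fundamental_theorem_of_calculus)
    fix x
    have "((\<lambda>x. \<phi> x * \<eta> x) has_real_derivative \<phi> x * deriv \<eta> x + deriv \<phi> x * \<eta> x) (at x within {c..d})"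
      by (rule has_field_derivative_at_within[OF DERIV_mult'[OF \<phi>' \<eta>']])
    then show "((\<lambda>x. \<phi> x * \<eta> x) has_vector_derivative \<phi> x * deriv \<eta> x + deriv \<phi> x * \<eta> x) (at x within {c..d})"
      by (simp only: has_real_derivative_iff_has_vector_derivative)
  qed (use assms(3) in simp)
  moreover have "\<eta> c = 0" "\<eta> d = 0"
    unfolding \<eta>_def by (rule deriv_zero_at_endpoints[OF assms(2)]; simp)+
  ultimately have "0 = integral {c..d} (\<lambda>x. \<phi> x * deriv \<eta> x + deriv \<phi> x * \<eta> x)"
    by (simp add: integral_unique)
  also have "\<dots> = (\<integral>x. \<phi> x * deriv \<eta> x + deriv \<phi> x * \<eta> x \<partial>lebesgue_on {c<..<d})"
    by (rule continuous_integrable_Ioo(2)[symmetric]) (intro continuous_intros cont)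
  also have "\<dots> = (\<integral>x. \<phi> x * deriv \<eta> x \<partial>lebesgue_on {c<..<d}) + (\<integral>x. deriv \<phi> x * \<eta> x \<partial>lebesgue_on {c<..<d})"
    by (intro Bochner_Integration.integral_add continuous_integrable_Ioo continuous_intros cont)
  finally have "(\<integral>x. \<phi> x * deriv \<eta> x \<partial>lebesgue_on {c<..<d}) = - (\<integral>x. deriv \<phi> x * \<eta> x \<partial>lebesgue_on {c<..<d})"
    by linarith
  also have "(\<integral>x. deriv \<phi> x * \<eta> x \<partial>lebesgue_on {c<..<d}) =
     (- 1) ^ k * (\<integral>x. (deriv ^^ k) (deriv \<phi>) x * \<psi> x \<partial>lebesgue_on {c<..<d})"
    unfolding \<eta>_def using smooth_deriv[OF Suc.prems, of 1] by (intro Suc.IH) simp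
  also have "(deriv ^^ k) (deriv \<phi>) = (deriv ^^ Suc k) \<phi>" by (simp add: funpow_swap1)
  finally show ?case by (simp add: \<eta>_def)
qed simp

lemma tendsto_integral_times_bounded:
  fixes f :: "nat \<Rightarrow> real \<Rightarrow> real"
  assumes "\<And>h. integrable M (f h)" "integrable M f'" "g \<in> borel_measurable M" "\<And>x. x \<in> space M \<Longrightarrow> \<bar>g x\<bar> \<le> B"
    and lim: "(\<lambda>h. \<integral>x. \<bar>f' x - f h x\<bar> \<partial>M) \<longlonglongrightarrow> 0"
  shows "(\<lambda>h. \<integral>x. f h x * g x \<partial>M) \<longlonglongrightarrow> (\<integral>x. f' x * g x \<partial>M)"
proof (rule LIM_zero_cancel, rule Lim_null_comparison)
  have g: "\<bar>g x\<bar> \<le> \<bar>B\<bar>" if "x \<in> space M" for x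
    using assms(4)[OF that] by linarith
  have int: "integrable M (\<lambda>x. F x * g x)" if "integrable M F" for F
  proof (rule Bochner_Integration.integrable_bound)
    show "integrable M (\<lambda>x. F x * \<bar>B\<bar>)" using that by simp
    show "AE x in M. norm (F x * g x) \<le> norm (F x * \<bar>B\<bar>)"
      using g by (intro AE_I2) (auto simp: abs_mult intro!: mult_left_mono)
  qed (use that assms(3) in measurable)
  show "\<forall>\<^sub>F h in sequentially. norm ((\<integral>x. f h x * g x \<partial>M) - (\<integral>x. f' x * g x \<partial>M)) \<le> \<bar>B\<bar> * (\<integral>x. \<bar>f' x - f h x\<bar> \<partial>M)"
  proof (intro always_eventually allI)
    fix h
    have d: "integrable M (\<lambda>x. f' x - f h x)" using assms by simp
    have "norm ((\<integral>x. f h x * g x \<partial>M) - (\<integral>x. f' x * g x \<partial>M)) = norm (\<integral>x. (f' x - f h x) * g x \<partial>M)"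
      using int[OF assms(1)] int[OF assms(2)] by (simp add: left_diff_distrib abs_minus_commute)
    also have "\<dots> \<le> (\<integral>x. norm ((f' x - f h x) * g x) \<partial>M)" by (rule integral_norm_bound)
    also have "\<dots> \<le> (\<integral>x. \<bar>f' x - f h x\<bar> * \<bar>B\<bar> \<partial>M)"
      using int[OF d] d g
      by (intro integral_mono integrable_norm) (auto simp: abs_mult intro!: mult_left_mono)
    finally show "norm ((\<integral>x. f h x * g x \<partial>M) - (\<integral>x. f' x * g x \<partial>M)) \<le> \<bar>B\<bar> * (\<integral>x. \<bar>f' x - f h x\<bar> \<partial>M)"
      by (simp add: mult.commute[of "\<bar>B\<bar>"])
  qed
  show "(\<lambda>h. \<bar>B\<bar> * (\<integral>x. \<bar>f' x - f h x\<bar> \<partial>M)) \<longlonglongrightarrow> 0"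
    using tendsto_mult_left[OF lim] by simp
qed

text \<open>
  The one-dimensional Sobolev inequality: \<open>\<bar>f x\<bar>\<close> exceeds \<open>\<bar>f y\<bar>\<close> by at most the integral of \<open>\<bar>f'\<bar>\<close>;
  average over \<open>y\<close>.
\<close>

lemma sup_le_L1_norms:
  assumes C1: "C1 f f'" and cd: "c < d" and x: "x \<in> {c<..<d}"
  shows "\<bar>f x\<bar> \<le> (\<integral>y. \<bar>f y\<bar> \<partial>lebesgue_on {c<..<d}) / (d - c) + (\<integral>y. \<bar>f' y\<bar> \<partial>lebesgue_on {c<..<d})"
proof -
  note cont = C1_continuous[OF C1]
  define I where "I = integral {c..d} (\<lambda>y. \<bar>f' y\<bar>)"
  have osc: "\<bar>f z - f y\<bar> \<le> I" if "c \<le> y" "y \<le> z" "z \<le> d" for y z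
    using that unfolding I_def
    by (intro order_trans[OF oscillation_le_integral_deriv[OF C1]] integral_mono_set continuous_intros cont) auto
  have "(d - c) * (\<bar>f x\<bar> - I) = integral {c..d} (\<lambda>y. \<bar>f x\<bar> - I)" using cd by simp
  also have "\<dots> \<le> integral {c..d} (\<lambda>y. \<bar>f y\<bar>)"
  proof (intro integral_le integrable_continuous_interval continuous_intros cont)
    fix y assume y: "y \<in> {c..d}"
    show "\<bar>f x\<bar> - I \<le> \<bar>f y\<bar>"
    proof (cases "x \<le> y")
      case True then show ?thesis using osc[of x y] x y by auto
    next
      case False then show ?thesis using osc[of y x] x y by auto
    qed
  qed
  finally have "\<bar>f x\<bar> \<le> integral {c..d} (\<lambda>y. \<bar>f y\<bar>) / (d - c) + I" using cd by (simp add: field_simps)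
  moreover have "(\<integral>y. \<bar>f y\<bar> \<partial>lebesgue_on {c<..<d}) = integral {c..d} (\<lambda>y. \<bar>f y\<bar>)"
      "(\<integral>y. \<bar>f' y\<bar> \<partial>lebesgue_on {c<..<d}) = I"
    unfolding I_def by (rule continuous_integrable_Ioo(2), intro continuous_intros cont)+
  ultimately show ?thesis by simp
qed

lemma integrable_imp_locally_integrable_on:
  assumes "integrable (lebesgue_on S) f" "S \<in> sets lebesgue"
  shows "locally_integrable_on f S"
  unfolding locally_integrable_on_def
proof (intro allI impI)
  fix K assume "compact K \<and> K \<subseteq> S"
  then show "integrable (lebesgue_on K) f"
    by (intro integrable_lebesgue_on_subset[OF assms(1) _ _ assms(2)]) (auto intro: lmeasurable_compact fmeasurableD)
qed

text \<open>
  The chosen weak derivative is only known to be locally integrable, but by uniqueness it agrees almost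
  everywhere with the given integrable one.
\<close>

lemma weak_deriv_L1_norm:
  assumes "has_weak_deriv {c<..<d} k u v" "integrable (lebesgue_on {c<..<d}) v"
  shows "(\<integral>x. \<bar>weak_deriv {c<..<d} k u x\<bar> \<partial>lebesgue_on {c<..<d}) = (\<integral>x. \<bar>v x\<bar> \<partial>lebesgue_on {c<..<d})"
proof -
  have "has_weak_deriv {c<..<d} k u (weak_deriv {c<..<d} k u)"
    unfolding weak_deriv_def by (rule someI[of "has_weak_deriv {c<..<d} k u", OF assms(1)])
  then have AE: "AE x in lebesgue_on {c<..<d}. v x = weak_deriv {c<..<d} k u x"
    by (rule has_weak_deriv_unique[OF assms(1)])
  have "weak_deriv {c<..<d} k u \<in> borel_measurable (lebesgue_on {c<..<d})"
    using assms(2) AE by (intro borel_measurable_lebesgue_on_AE[OF _ _ AE]) auto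
  then show ?thesis
    using AE assms(2) by (intro integral_cong_AE) (auto elim!: eventually_mono)
qed

context controlled_interval
begin

context
  fixes v :: "nat \<Rightarrow> real \<Rightarrow> real" and \<phi> :: "nat \<Rightarrow> real \<Rightarrow> real"
  assumes v: "\<And>i. i \<le> m \<Longrightarrow> v i \<in> Lp_space \<mu> p"
    and \<phi>: "\<And>h. \<phi> h \<in> test_functions UNIV"
    and lim: "\<And>i. i \<le> m \<Longrightarrow> (\<lambda>h. Lp_norm \<mu> p (\<lambda>x. (deriv ^^ i) (\<phi> h) x - v i x)) \<longlonglongrightarrow> 0"
begin

lemma tangential_L1:
  assumes "k \<le> n"
  shows "integrable (lebesgue_on U) (v k)"
    and "(\<integral>x. \<bar>v k x\<bar> \<partial>lebesgue_on U) \<le> 4 * C * Lp_norm_sum \<mu> p m v"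
proof -
  have 0: "(deriv ^^ i) (\<lambda>x::real. 0::real) = (\<lambda>x. 0)" for i
    by (induction i) (auto intro!: DERIV_imp_deriv)
  show "integrable (lebesgue_on U) (v k)" "(\<integral>x. \<bar>v k x\<bar> \<partial>lebesgue_on U) \<le> 4 * C * Lp_norm_sum \<mu> p m v"
    using limit_deriv_bound[OF v \<phi> lim zero_test_function assms] unfolding 0 by simp_all
qed

lemma test_derivs_tendsto_L1:
  assumes "k \<le> n"
  shows "(\<lambda>h. \<integral>x. \<bar>v k x - (deriv ^^ k) (\<phi> h) x\<bar> \<partial>lebesgue_on U) \<longlonglongrightarrow> 0"
proof (rule tendsto_sandwich[OF _ _ tendsto_const])
  let ?S = "\<lambda>h. Lp_norm_sum \<mu> p m (\<lambda>i x. v i x - (deriv ^^ i) (\<phi> h) x)"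
  show "\<forall>\<^sub>F h in sequentially. (\<integral>x. \<bar>v k x - (deriv ^^ k) (\<phi> h) x\<bar> \<partial>lebesgue_on U) \<le> 4 * C * ?S h"
    using limit_deriv_bound(2)[OF v \<phi> lim \<phi> assms] by (intro always_eventually allI)
  have "?S \<longlonglongrightarrow> (\<Sum>i\<le>m. 0)"
    unfolding Lp_norm_sum_def by (subst Lp_norm_minus_commute) (intro tendsto_sum lim, simp)
  then have "?S \<longlonglongrightarrow> 0" by simp
  from tendsto_mult_left[OF this, of "4 * C"] show "(\<lambda>h. 4 * C * ?S h) \<longlonglongrightarrow> 0" by simp
  show "\<forall>\<^sub>F h in sequentially. 0 \<le> (\<integral>x. \<bar>v k x - (deriv ^^ k) (\<phi> h) x\<bar> \<partial>lebesgue_on U)"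
    by (intro always_eventually allI Bochner_Integration.integral_nonneg) simp
qed

lemma tangential_is_weak_deriv:
  assumes "k \<le> n"
  shows "has_weak_deriv U k (v 0) (v k)"
  unfolding has_weak_deriv_def
proof (intro conjI ballI)
  show "locally_integrable_on (v 0) U" "locally_integrable_on (v k) U"
    by (intro integrable_imp_locally_integrable_on tangential_L1(1) assms; simp)+
  fix \<psi> assume \<psi>: "\<psi> \<in> test_functions U"
  have test: "(\<lambda>h. \<integral>x. (deriv ^^ i) (\<phi> h) x * (deriv ^^ j) \<psi> x \<partial>lebesgue_on U) \<longlonglongrightarrow>
      (\<integral>x. v i x * (deriv ^^ j) \<psi> x \<partial>lebesgue_on U)" if "i \<le> n" for i j
  proof -
    have cont: "continuous_on S ((deriv ^^ j) \<psi>)" for S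
      by (intro smooth_deriv_continuous test_functionsD(1)[OF \<psi>])
    have "compact ((deriv ^^ j) \<psi> ` {c..d})" by (intro compact_continuous_image cont) simp
    then have "bounded ((deriv ^^ j) \<psi> ` {c..d})" by (rule compact_imp_bounded)
    then obtain B where B: "\<forall>y\<in>(deriv ^^ j) \<psi> ` {c..d}. norm y \<le> B" unfolding bounded_iff by blast
    show ?thesis
    proof (rule tendsto_integral_times_bounded[where B=B])
      show "(deriv ^^ j) \<psi> \<in> borel_measurable (lebesgue_on U)"
        by (rule continuous_borel_measurable_lebesgue_on[OF cont])
    qed (use B test_deriv_integrable[OF \<phi>] tangential_L1(1)[OF that] test_derivs_tendsto_L1[OF that] in auto)
  qed
  have "(\<lambda>h. (- 1) ^ k * (\<integral>x. (deriv ^^ k) (\<phi> h) x * (deriv ^^ 0) \<psi> x \<partial>lebesgue_on U))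
    \<longlonglongrightarrow> (- 1) ^ k * (\<integral>x. v k x * (deriv ^^ 0) \<psi> x \<partial>lebesgue_on U)"
    by (intro tendsto_mult_left test assms)
  moreover have "(- 1) ^ k * (\<integral>x. (deriv ^^ k) (\<phi> h) x * (deriv ^^ 0) \<psi> x \<partial>lebesgue_on U) =
    (\<integral>x. (deriv ^^ 0) (\<phi> h) x * (deriv ^^ k) \<psi> x \<partial>lebesgue_on U)" for h
    using integration_by_parts_test_function[OF test_functionsD(1)[OF \<phi>] \<psi> cd] by simp
  ultimately have "(\<lambda>h. \<integral>x. (deriv ^^ 0) (\<phi> h) x * (deriv ^^ k) \<psi> x \<partial>lebesgue_on U)
    \<longlonglongrightarrow> (- 1) ^ k * (\<integral>x. v k x * \<psi> x \<partial>lebesgue_on U)"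
    by (simp only: funpow_0)
  from LIMSEQ_unique[OF test[of 0 k] this]
  show "(\<integral>x. v 0 x * (deriv ^^ k) \<psi> x \<partial>lebesgue_on U) = (- 1) ^ k * (\<integral>x. v k x * \<psi> x \<partial>lebesgue_on U)"
    by simp
qed

text \<open>
  The Sobolev inequality turns \<open>L\<^sup>1\<close> convergence of the derivatives of orders \<open>k\<close> and \<open>k + 1\<close> into a
  uniform Cauchy property for order \<open>k\<close>; the uniform limit and the \<open>L\<^sup>1\<close> limit agree almost everywhere.
\<close>

lemma test_derivs_uniform_limit:
  assumes "k < n"
  obtains g where "uniform_limit U (\<lambda>h. (deriv ^^ k) (\<phi> h)) g sequentially" "AE x in lebesgue_on U. v k x = g x"
proof -
  define e where "e = (\<lambda>k h. \<integral>x. \<bar>v k x - (deriv ^^ k) (\<phi> h) x\<bar> \<partial>lebesgue_on U)"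
  \<comment> \<open>the right-hand side of the Sobolev inequality for the distance of \<open>\<phi> h\<close> to the limit\<close>
  define s where "s = (\<lambda>h. e k h / (d - c) + e (Suc k) h)"
  have e0: "e i \<longlonglongrightarrow> 0" if "i \<le> n" for i unfolding e_def using test_derivs_tendsto_L1[OF that] .
  have "s \<longlonglongrightarrow> 0 / (d - c) + 0" unfolding s_def
    using assms cd by (intro tendsto_intros e0) auto
  then have s0: "s \<longlonglongrightarrow> 0" by simp
  have diff: "(\<integral>x. \<bar>(deriv ^^ i) (\<phi> h) x - (deriv ^^ i) (\<phi> l) x\<bar> \<partial>lebesgue_on U) \<le> e i h + e i l" if "i \<le> n" for i h l
  proof -
    note int = tangential_L1(1)[OF that] test_deriv_integrable[OF \<phi>, where k=i]
    have "(\<integral>x. \<bar>(deriv ^^ i) (\<phi> h) x - (deriv ^^ i) (\<phi> l) x\<bar> \<partial>lebesgue_on U) \<le>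
      (\<integral>x. \<bar>v i x - (deriv ^^ i) (\<phi> h) x\<bar> + \<bar>v i x - (deriv ^^ i) (\<phi> l) x\<bar> \<partial>lebesgue_on U)"
      using int by (intro integral_mono) auto
    also have "\<dots> = e i h + e i l" unfolding e_def using int by simp
    finally show ?thesis .
  qed
  have bound: "\<bar>(deriv ^^ k) (\<phi> h) x - (deriv ^^ k) (\<phi> l) x\<bar> \<le> s h + s l" if "x \<in> U" for x h l
  proof -
    have sm: "smooth (\<phi> h)" "smooth (\<phi> l)" using \<phi> test_functionsD(1) by blast+
    have "C1 (\<lambda>x. (deriv ^^ k) (\<phi> h) x - (deriv ^^ k) (\<phi> l) x) (\<lambda>x. (deriv ^^ Suc k) (\<phi> h) x - (deriv ^^ Suc k) (\<phi> l) x)"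
      using C1_deriv[OF test_functions_diff[OF \<phi>[of h] \<phi>[of l]], of k]
      unfolding deriv_funpow_diff[OF sm] .
    from sup_le_L1_norms[OF this cd that]
    have "\<bar>(deriv ^^ k) (\<phi> h) x - (deriv ^^ k) (\<phi> l) x\<bar> \<le> (e k h + e k l) / (d - c) + (e (Suc k) h + e (Suc k) l)"
      using diff[of k h l] diff[of "Suc k" h l] assms cd
      by (elim order_trans) (intro add_mono divide_right_mono, auto)
    then show ?thesis by (simp add: s_def add_divide_distrib)
  qed
  have "uniformly_Cauchy_on U (\<lambda>h. (deriv ^^ k) (\<phi> h))"
  proof (rule uniformly_Cauchy_onI)
    fix \<epsilon> :: real assume "\<epsilon> > 0"
    then have "\<forall>\<^sub>F h in sequentially. s h < \<epsilon> / 2" using order_tendstoD(2)[OF s0, of "\<epsilon> / 2"] by simp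
    then obtain N where N: "\<And>h. h \<ge> N \<Longrightarrow> s h < \<epsilon> / 2" unfolding eventually_sequentially by blast
    show "\<exists>N. \<forall>x\<in>U. \<forall>h\<ge>N. \<forall>l\<ge>N. dist ((deriv ^^ k) (\<phi> h) x) ((deriv ^^ k) (\<phi> l) x) < \<epsilon>"
    proof (intro exI ballI allI impI)
      fix x h l assume "x \<in> U" "N \<le> h" "N \<le> l"
      then show "dist ((deriv ^^ k) (\<phi> h) x) ((deriv ^^ k) (\<phi> l) x) < \<epsilon>"
        using bound[of x h l] N[of h] N[of l] by (simp add: dist_real_def)
    qed
  qed
  then obtain g where g: "uniform_limit U (\<lambda>h. (deriv ^^ k) (\<phi> h)) g sequentially"
    using Cauchy_uniformly_convergent uniformly_convergent_on_def by blast
  have int: "integrable (lebesgue_on U) (\<lambda>x. v k x - (deriv ^^ k) (\<phi> h) x)" for h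
    using tangential_L1(1)[of k] test_deriv_integrable[OF \<phi>] assms by simp
  have "(\<lambda>h. \<integral>x. norm (v k x - (deriv ^^ k) (\<phi> h) x) \<partial>lebesgue_on U) \<longlonglongrightarrow> 0"
    using e0[of k] assms by (simp add: e_def)
  then obtain r where r: "strict_mono r" "AE x in lebesgue_on U. (\<lambda>h. v k x - (deriv ^^ k) (\<phi> (r h)) x) \<longlonglongrightarrow> 0"
    using tendsto_L1_AE_subseq[of "lebesgue_on U" "\<lambda>h x. v k x - (deriv ^^ k) (\<phi> h) x", OF int] by blast
  have "AE x in lebesgue_on U. x \<in> U" by (intro AE_I2) simp
  with r(2) have "AE x in lebesgue_on U. v k x = g x"
  proof eventually_elim
    case (elim x)
    have "(\<lambda>h. (deriv ^^ k) (\<phi> h) x) \<longlonglongrightarrow> g x" using tendsto_uniform_limitI[OF g elim(2)] .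
    then have "(\<lambda>h. v k x - (deriv ^^ k) (\<phi> (r h)) x) \<longlonglongrightarrow> v k x - g x"
      using LIMSEQ_subseq_LIMSEQ[OF _ r(1)] by (intro tendsto_intros) (auto simp: o_def)
    then show ?case using LIMSEQ_unique[OF elim(1)] by force
  qed
  with g show ?thesis by (rule that)
qed

text \<open>
  The uniform limits \<open>g k\<close> of the \<open>k\<close>-th derivatives satisfy \<open>g k' = g (k + 1)\<close> because the derivatives
  of the approximations converge uniformly as well, so \<open>g 0\<close> is the representative. For the order
  \<open>\<kappa> + 1\<close> only convergence in \<open>L\<^sup>1\<close> is available, which is why the regularity stops at \<open>C\<^sup>\<kappa>\<close>.
\<close>

lemma Ck_representative:
  assumes "n = Suc \<kappa>"
  obtains u' where "u' \<in> Ck_on \<kappa> U" "\<And>k. k \<le> \<kappa> \<Longrightarrow> AE x in lebesgue_on U. v k x = (deriv ^^ k) u' x"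
proof -
  have "\<forall>k. \<exists>g. k \<le> \<kappa> \<longrightarrow> uniform_limit U (\<lambda>h. (deriv ^^ k) (\<phi> h)) g sequentially \<and> (AE x in lebesgue_on U. v k x = g x)"
  proof (intro allI)
    fix k
    show "\<exists>g. k \<le> \<kappa> \<longrightarrow> uniform_limit U (\<lambda>h. (deriv ^^ k) (\<phi> h)) g sequentially \<and> (AE x in lebesgue_on U. v k x = g x)"
    proof (cases "k \<le> \<kappa>")
      case True
      then have "k < n" using assms by simp
      then obtain g where "uniform_limit U (\<lambda>h. (deriv ^^ k) (\<phi> h)) g sequentially" "AE x in lebesgue_on U. v k x = g x"
        by (rule test_derivs_uniform_limit)
      then show ?thesis by (intro exI[of _ g]) simp
    qed simp
  qed
  from choice[OF this] obtain g where "\<forall>k. k \<le> \<kappa> \<longrightarrow>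
      uniform_limit U (\<lambda>h. (deriv ^^ k) (\<phi> h)) (g k) sequentially \<and> (AE x in lebesgue_on U. v k x = g k x)" ..
  then have g: "uniform_limit U (\<lambda>h. (deriv ^^ k) (\<phi> h)) (g k) sequentially" "AE x in lebesgue_on U. v k x = g k x"
    if "k \<le> \<kappa>" for k
    using that by simp_all
  have smooth: "smooth (\<phi> h)" for h using \<phi> test_functionsD(1) by blast
  have contg: "continuous_on U (g k)" if "k \<le> \<kappa>" for k
    by (rule uniform_limit_theorem[OF _ g(1)[OF that]])
      (auto intro!: always_eventually smooth_deriv_continuous smooth)
  have derivg: "(g k has_real_derivative g (Suc k) x) (at x)" if "k < \<kappa>" "x \<in> U" for k x
  proof -
    have conv: "(\<lambda>h. (deriv ^^ k) (\<phi> h) y) \<longlonglongrightarrow> g k y" if "y \<in> U" for y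
      using tendsto_uniform_limitI[OF g(1) that] \<open>k < \<kappa>\<close> by simp
    have "\<exists>G. \<forall>y\<in>U. (\<lambda>h. (deriv ^^ k) (\<phi> h) y) \<longlonglongrightarrow> G y \<and> (G has_derivative (*) (g (Suc k) y)) (at y within U)"
    proof (rule has_derivative_sequence[where f'="\<lambda>h y. (*) ((deriv ^^ Suc k) (\<phi> h) y)"])
      show "((deriv ^^ k) (\<phi> h) has_derivative (*) ((deriv ^^ Suc k) (\<phi> h) y)) (at y within U)" for h y
        using smooth_deriv_has_deriv[OF smooth, of k h y]
        unfolding has_field_derivative_def by (rule has_derivative_at_withinI)
      show "\<forall>\<^sub>F h in sequentially. \<forall>y\<in>U. \<forall>t. norm ((deriv ^^ Suc k) (\<phi> h) y * t - g (Suc k) y * t) \<le> \<epsilon> * norm t"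
        if "\<epsilon> > 0" for \<epsilon>
        using uniform_limitD[OF g(1)[OF Suc_leI[OF \<open>k < \<kappa>\<close>]] that]
      proof eventually_elim
        case (elim h)
        show ?case
        proof (intro ballI allI)
          fix y t assume "y \<in> U"
          then have "\<bar>(deriv ^^ Suc k) (\<phi> h) y - g (Suc k) y\<bar> \<le> \<epsilon>" using elim by (auto simp: dist_real_def less_imp_le)
          then show "norm ((deriv ^^ Suc k) (\<phi> h) y * t - g (Suc k) y * t) \<le> \<epsilon> * norm t"
            unfolding left_diff_distrib[symmetric] norm_mult by (intro mult_right_mono) auto
        qed
      qed
    qed (use that conv in auto)
    then obtain G where G: "\<And>y. y \<in> U \<Longrightarrow> (\<lambda>h. (deriv ^^ k) (\<phi> h) y) \<longlonglongrightarrow> G y"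
      "\<And>y. y \<in> U \<Longrightarrow> (G has_derivative (*) (g (Suc k) y)) (at y within U)" by blast
    have "(G has_real_derivative g (Suc k) x) (at x)"
      using G(2)[OF that(2)] that(2) at_within_open[of x U] by (simp add: has_field_derivative_def)
    then show ?thesis
      using that(2) LIMSEQ_unique[OF G(1) conv]
      by (elim has_field_derivative_transform_within_open[of _ _ _ U]) auto
  qed
  have derivs: "\<forall>x\<in>U. (deriv ^^ k) (g 0) x = g k x" if "k \<le> \<kappa>" for k
    using that
  proof (induction k)
    case (Suc k)
    show ?case
    proof
      fix x assume x: "x \<in> U"
      have "((deriv ^^ k) (g 0) has_real_derivative g (Suc k) x) (at x)"
        using derivg[OF Suc_le_lessD[OF Suc.prems] x] Suc x by (elim has_field_derivative_transform_within_open[of _ _ _ U]) auto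
      then show "(deriv ^^ Suc k) (g 0) x = g (Suc k) x" by (simp add: DERIV_imp_deriv)
    qed
  qed simp
  have has_deriv: "((deriv ^^ k) (g 0) has_real_derivative g (Suc k) x) (at x)" if "k < \<kappa>" "x \<in> U" for k x
    using derivg[OF that] derivs[of k] that
    by (elim has_field_derivative_transform_within_open[of _ _ _ U]) auto
  have "g 0 \<in> Ck_on \<kappa> U"
    unfolding Ck_on_def
  proof (intro CollectI conjI allI impI ballI)
    show "(deriv ^^ i) (g 0) differentiable at x" if "i < \<kappa>" "x \<in> U" for i x
      using has_deriv[OF that] by (auto simp: real_differentiable_def)
    show "continuous_on U ((deriv ^^ i) (g 0))" if "i \<le> \<kappa>" for i
      using contg[OF that] derivs[OF that] by (subst continuous_on_cong[OF refl, of U _ "g i"]) auto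
  qed
  moreover have "AE x in lebesgue_on U. v k x = (deriv ^^ k) (g 0) x" if "k \<le> \<kappa>" for k
    by (rule lebesgue_on_mono[OF g(2)[OF that]]) (use derivs[OF that] in auto)
  ultimately show ?thesis by (rule that)
qed

end

end

section \<open>Embedding and classical representatives\<close>

lemma has_tangential_derivs_tangential_deriv:
  assumes "u \<in> H_space a b w p m"
  shows "has_tangential_derivs a b w p m u (\<lambda>k. tangential_deriv a b w p m k u)"
  using assms someI_ex[of "has_tangential_derivs a b w p m u"]
  by (auto simp: H_space_def tangential_deriv_def)

lemma Lp_norm_sum_le_H_norm:
  assumes "1 \<le> p"
  shows "Lp_norm_sum (weight_measure a b w) p m (\<lambda>k. tangential_deriv a b w p m k u) \<le> real (Suc m) * H_norm a b w p m u"
proof -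
  let ?N = "\<lambda>k. Lp_norm (weight_measure a b w) p (tangential_deriv a b w p m k u)"
  have "?N k \<le> H_norm a b w p m u" if "k \<le> m" for k
  proof -
    have "?N k = (?N k powr p) powr (1 / p)" using assms by (simp add: powr_powr Lp_norm_def)
    also have "\<dots> \<le> H_norm a b w p m u"
      unfolding H_norm_def using assms that
      by (intro powr_mono2 member_le_sum) auto
    finally show ?thesis .
  qed
  then have "(\<Sum>k\<le>m. ?N k) \<le> (\<Sum>k\<le>m. H_norm a b w p m u)" by (intro sum_mono) simp
  then show ?thesis by (simp add: Lp_norm_sum_def)
qed

text \<open>
  Both conclusions use the particular family of tangential derivatives selected by
  \<open>tangential_deriv\<close>; the selection is made once for all orders, so the family comes with a single
  approximating sequence.
\<close>

lemma regularity_if_controls_derivs: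
  assumes w: "weight_on a b w" and p: "1 \<le> p" and "a \<le> c" "c < d" "d \<le> b"
    and pos: "AE x in lebesgue_on {c<..<d}. 0 < w x" and "\<kappa> < m"
    and control: "controls_derivs (weight_measure a b w) p m (Suc \<kappa>) {c<..<d}"
  shows "H_embeds_in_W1 a b w p m {c<..<d} (\<kappa> + 1)"
    and "\<And>u. u \<in> H_space a b w p m \<Longrightarrow> \<exists>u'\<in>Ck_on \<kappa> {c<..<d}. \<forall>k\<in>{0..\<kappa>}.
      (AE x in lebesgue_on {c<..<d}. u x = u' x) \<and>
      (AE x in lebesgue_on {c<..<d}. tangential_deriv a b w p m k u x = (deriv ^^ k) u' x)"
proof -
  obtain C where C: "0 \<le> C" "\<And>\<phi> k. \<phi> \<in> test_functions UNIV \<Longrightarrow> k \<le> Suc \<kappa> \<Longrightarrow>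
      (\<integral>x. \<bar>(deriv ^^ k) \<phi> x\<bar> \<partial>lebesgue_on {c<..<d})
        \<le> C * Lp_norm_sum (weight_measure a b w) p m (\<lambda>i. (deriv ^^ i) \<phi>)"
    using control unfolding controls_derivs_def by blast
  interpret controlled_interval a b p w m "Suc \<kappa>" c d C
    by unfold_locales (use assms C in auto)
  have data: "\<exists>\<phi>. v 0 = u \<and> (\<forall>i\<le>m. v i \<in> Lp_space \<mu> p) \<and> (\<forall>h. \<phi> h \<in> test_functions UNIV) \<and>
      (\<forall>i\<le>m. (\<lambda>h. Lp_norm \<mu> p (\<lambda>x. (deriv ^^ i) (\<phi> h) x - v i x)) \<longlonglongrightarrow> 0)"
    if "u \<in> H_space a b w p m" "v = (\<lambda>k. tangential_deriv a b w p m k u)" for u v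
    using has_tangential_derivs_tangential_deriv[OF that(1)] unfolding that(2) has_tangential_derivs_def by blast
  show "H_embeds_in_W1 a b w p m U (\<kappa> + 1)"
    unfolding H_embeds_in_W1_def
  proof (intro exI[of _ "real (Suc (Suc \<kappa>)) * (4 * C * real (Suc m))"] ballI conjI)
    fix u assume u: "u \<in> H_space a b w p m"
    define v where "v = (\<lambda>k. tangential_deriv a b w p m k u)"
    obtain \<phi> where v0: "v 0 = u" and v: "\<And>i. i \<le> m \<Longrightarrow> v i \<in> Lp_space \<mu> p"
      and \<phi>: "\<And>h. \<phi> h \<in> test_functions UNIV"
      and lim: "\<And>i. i \<le> m \<Longrightarrow> (\<lambda>h. Lp_norm \<mu> p (\<lambda>x. (deriv ^^ i) (\<phi> h) x - v i x)) \<longlonglongrightarrow> 0"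
      using data[OF u v_def] by blast
    note L1 = tangential_L1[OF v \<phi> lim]
    note weak = tangential_is_weak_deriv[OF v \<phi> lim, unfolded v0]
    show "u \<in> W1_space U (\<kappa> + 1)"
      unfolding W1_space_def
    proof (intro CollectI conjI ballI)
      show "integrable (lebesgue_on U) u" using L1(1)[of 0] by (simp add: v0)
      fix k assume k: "k \<in> {1..\<kappa> + 1}"
      show "\<exists>v. has_weak_deriv U k u v \<and> integrable (lebesgue_on U) v"
        by (rule exI[of _ "v k"]) (use weak[of k] L1(1)[of k] k in simp)
    qed
    \<comment> \<open>bounds the \<open>L\<^sup>1\<close> norm of each of the \<open>\<kappa> + 2\<close> functions that enter the Sobolev norm\<close>
    define B where "B = 4 * C * real (Suc m) * H_norm a b w p m u"
    have bound: "(\<integral>x. \<bar>v k x\<bar> \<partial>lebesgue_on U) \<le> B" if "k \<le> Suc \<kappa>" for k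
    proof -
      have "4 * C * Lp_norm_sum \<mu> p m v \<le> 4 * C * (real (Suc m) * H_norm a b w p m u)"
        unfolding v_def using Lp_norm_sum_le_H_norm[OF p] C(1) by (intro mult_left_mono) auto
      moreover have "(\<integral>x. \<bar>v k x\<bar> \<partial>lebesgue_on U) \<le> 4 * C * Lp_norm_sum \<mu> p m v"
        by (rule L1(2)) (use that in auto)
      ultimately show ?thesis by (simp add: B_def mult.assoc)
    qed
    have "(\<integral>x. \<bar>weak_deriv U k u x\<bar> \<partial>lebesgue_on U) = (\<integral>x. \<bar>v k x\<bar> \<partial>lebesgue_on U)" if "k \<in> {1..\<kappa> + 1}" for k
      using that by (intro weak_deriv_L1_norm weak L1(1)) auto
    then have "W1_norm U (\<kappa> + 1) u = (\<integral>x. \<bar>v 0 x\<bar> \<partial>lebesgue_on U) + (\<Sum>k=1..\<kappa> + 1. \<integral>x. \<bar>v k x\<bar> \<partial>lebesgue_on U)"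
      unfolding W1_norm_def v0 by (intro arg_cong2[of _ _ _ _ "(+)"] sum.cong) auto
    also have "\<dots> \<le> B + (\<Sum>k=1..\<kappa> + 1. B)"
      by (intro add_mono sum_mono bound) auto
    also have "\<dots> = real (Suc (Suc \<kappa>)) * (4 * C * real (Suc m)) * H_norm a b w p m u"
      by (simp add: B_def algebra_simps)
    finally show "W1_norm U (\<kappa> + 1) u \<le> real (Suc (Suc \<kappa>)) * (4 * C * real (Suc m)) * H_norm a b w p m u" .
  qed
  fix u assume u: "u \<in> H_space a b w p m"
  define v where "v = (\<lambda>k. tangential_deriv a b w p m k u)"
  obtain \<phi> where v0: "v 0 = u" and v: "\<And>i. i \<le> m \<Longrightarrow> v i \<in> Lp_space \<mu> p"
    and \<phi>: "\<And>h. \<phi> h \<in> test_functions UNIV"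
    and lim: "\<And>i. i \<le> m \<Longrightarrow> (\<lambda>h. Lp_norm \<mu> p (\<lambda>x. (deriv ^^ i) (\<phi> h) x - v i x)) \<longlonglongrightarrow> 0"
    using data[OF u v_def] by blast
  obtain u' where u': "u' \<in> Ck_on \<kappa> U" "\<And>k. k \<le> \<kappa> \<Longrightarrow> AE x in lebesgue_on U. v k x = (deriv ^^ k) u' x"
    using Ck_representative[OF v \<phi> lim refl] by blast
  show "\<exists>u'\<in>Ck_on \<kappa> U. \<forall>k\<in>{0..\<kappa>}. (AE x in lebesgue_on U. u x = u' x) \<and>
      (AE x in lebesgue_on U. tangential_deriv a b w p m k u x = (deriv ^^ k) u' x)"
    using u'(1) u'(2)[of 0] u'(2) unfolding v0 by (intro bexI[of _ u'] ballI conjI) (auto simp: v_def)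
qed

theorem corollary3p7:
  fixes a b p x0 :: real and w :: "real \<Rightarrow> real" and m kbar :: nat
  assumes "a < b"
    and "1 \<le> p"
    and "weight_on a b w"
    and "ae_noncritical a b w p"
    and "1 \<le> m"
    and "x0 \<in> {a..b}"
    and "kbar \<in> {0..m - 1}"
  shows "(x0 \<notin> critical_set a b w (real (m - kbar) - 1) p \<longrightarrow>
            (\<exists>V. openin (top_of_set {a..b}) V \<and> x0 \<in> V \<and>
               H_embeds_in_W1 a b w p m (V \<inter> {a<..<b}) (kbar + 1) \<and>
               (\<forall>u \<in> H_space a b w p m. \<exists>u' \<in> Ck_on kbar (V \<inter> {a<..<b}).
                  \<forall>k\<in>{0..kbar}.
                    (AE x in lebesgue_on V. u x = u' x) \<and>
                    (AE x in lebesgue_on V.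
                       tangential_deriv a b w p m k u x = (deriv ^^ k) u' x))))
       \<and> (critical_set a b w (real (m - kbar) - 1) p = {} \<longrightarrow>
            H_embeds_in_W1 a b w p m {a<..<b} (kbar + 1) \<and>
            (\<forall>u \<in> H_space a b w p m. \<exists>u' \<in> Ck_on kbar {a<..<b}.
               \<forall>k\<in>{0..kbar}.
                 (AE x in lebesgue_on {a<..<b}. u x = u' x) \<and>
                 (AE x in lebesgue_on {a<..<b}.
                    tangential_deriv a b w p m k u x = (deriv ^^ k) u' x)))"
proof (intro conjI impI)
  have kbar: "kbar < m" using assms(5,7) by auto
  have \<alpha>: "real (m - kbar) - 1 = real (m - Suc kbar)" using kbar by (simp add: of_nat_diff)
  {
    assume "x0 \<notin> critical_set a b w (real (m - kbar) - 1) p"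
    then have noncrit: "x0 \<notin> critical_set a b w (real (m - Suc kbar)) p" by (simp only: \<alpha> not_False_eq_True)
    obtain \<epsilon> where \<epsilon>: "\<epsilon> > 0" "AE x in lebesgue_on ({a<..<b} \<inter> ball x0 \<epsilon>). 0 < w x"
      "controls_derivs (weight_measure a b w) p m (Suc kbar) ({a<..<b} \<inter> ball x0 \<epsilon>)"
      by (rule noncritical_controls_derivs[OF assms(3,2,6) kbar noncrit])
    define V where "V = {a..b} \<inter> ball x0 \<epsilon>"
    define c d where "c = max a (x0 - \<epsilon>)" and "d = min b (x0 + \<epsilon>)"
    have U: "{a<..<b} \<inter> ball x0 \<epsilon> = {c<..<d}" by (simp add: ball_Int_Ioo c_def d_def)
    have VU: "V \<inter> {a<..<b} = {c<..<d}" unfolding U[symmetric] V_def by auto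
    have cd: "a \<le> c" "c < d" "d \<le> b" using assms(1,6) \<epsilon>(1) by (auto simp: c_def d_def)
    note reg = regularity_if_controls_derivs[OF assms(3,2) cd \<epsilon>(2)[unfolded U] kbar \<epsilon>(3)[unfolded U]]
    \<comment> \<open>\<open>V\<close> may contain \<open>a\<close> or \<open>b\<close>, which are null sets\<close>
    have V_AE: "AE x in lebesgue_on V. P x" if "AE x in lebesgue_on {c<..<d}. P x" for P
    proof -
      have "AE x in lebesgue. x \<in> {c<..<d} \<longrightarrow> P x"
        using that by (subst (asm) AE_lebesgue_on_iff) auto
      moreover have "AE x in lebesgue. x \<notin> {a, b}"
        by (intro AE_not_in) (simp add: negligible_iff_null_sets[symmetric])
      ultimately have "AE x in lebesgue. x \<in> V \<longrightarrow> P x"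
        by eventually_elim (auto simp: VU[symmetric] V_def)
      then show ?thesis by (subst AE_lebesgue_on_iff) (auto simp: V_def)
    qed
    show "\<exists>V. openin (top_of_set {a..b}) V \<and> x0 \<in> V \<and>
               H_embeds_in_W1 a b w p m (V \<inter> {a<..<b}) (kbar + 1) \<and>
               (\<forall>u \<in> H_space a b w p m. \<exists>u' \<in> Ck_on kbar (V \<inter> {a<..<b}).
                  \<forall>k\<in>{0..kbar}.
                    (AE x in lebesgue_on V. u x = u' x) \<and>
                    (AE x in lebesgue_on V.
                       tangential_deriv a b w p m k u x = (deriv ^^ k) u' x))"
    proof (intro exI[of _ V] conjI ballI)
      show "openin (top_of_set {a..b}) V" unfolding V_def by (simp add: openin_open_Int)
      show "x0 \<in> V" using assms(6) \<epsilon>(1) by (simp add: V_def)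
      show "H_embeds_in_W1 a b w p m (V \<inter> {a<..<b}) (kbar + 1)" unfolding VU by (rule reg(1))
      fix u assume "u \<in> H_space a b w p m"
      then obtain u' where "u' \<in> Ck_on kbar {c<..<d}" "\<forall>k\<in>{0..kbar}.
          (AE x in lebesgue_on {c<..<d}. u x = u' x) \<and>
          (AE x in lebesgue_on {c<..<d}. tangential_deriv a b w p m k u x = (deriv ^^ k) u' x)"
        using reg(2) by blast
      then show "\<exists>u' \<in> Ck_on kbar (V \<inter> {a<..<b}). \<forall>k\<in>{0..kbar}.
          (AE x in lebesgue_on V. u x = u' x) \<and>
          (AE x in lebesgue_on V. tangential_deriv a b w p m k u x = (deriv ^^ k) u' x)"
        unfolding VU by (intro bexI[of _ u'] ballI conjI V_AE) auto
    qed
  }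
  {
    assume "critical_set a b w (real (m - kbar) - 1) p = {}"
    then have noncrit: "critical_set a b w (real (m - Suc kbar)) p = {}" by (simp only: \<alpha>)
    note reg = regularity_if_controls_derivs[OF assms(3,2) order_refl assms(1) order_refl
        no_critical_controls_derivs(1)[OF assms(3,2) kbar noncrit] kbar
        no_critical_controls_derivs(2)[OF assms(3,2) kbar noncrit]]
    show "H_embeds_in_W1 a b w p m {a<..<b} (kbar + 1)" by (rule reg(1))
    show "\<forall>u \<in> H_space a b w p m. \<exists>u' \<in> Ck_on kbar {a<..<b}. \<forall>k\<in>{0..kbar}.
         (AE x in lebesgue_on {a<..<b}. u x = u' x) \<and>
         (AE x in lebesgue_on {a<..<b}. tangential_deriv a b w p m k u x = (deriv ^^ k) u' x)"
      by (intro ballI reg(2))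
  }
qed

end
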